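(* Let $\sigma_1,\sigma_2>0$ be fixed constants with $\sigma_1^2>\sigma_2^2$ (decreasing variances). For each positive integer $n$, let $M_n^{\downarrow}$ denote the maximal displacement at time $n$ of the two-variance binary branching random walk with parameters $(n,\sigma_1,\sigma_2)$ (defined in the context). Then, as a sequence indexed by $n$, $$M_n^{\downarrow}=\frac{\sqrt{2\log 2}\,(\sigma_1+\sigma_2)}{2}\,n-\frac{3(\sigma_1+\sigma_2)}{2\sqrt{2\log 2}}\log n+O_P(1),$$ which is of the form $$M_n=\left(\sqrt{2\log 2}\;\sigma_{\mathrm{eff}}\right)n-\beta\frac{\sigma_{\mathrm{eff}}}{\sqrt{2\log 2}}\log n+O_P(1)$$ with $\sigma_{\mathrm{eff}}=\frac{\sigma_1+\sigma_2}{2}$ and $\beta=3$.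
   Context: Two-variance binary branching random walk with parameters $(n,\sigma_1,\sigma_2)$: start with one particle at location $0\in\mathbb{R}$ at time $0$. If $v$ is a particle at location $S_v$ at time $k$ ($0\le k<n$), then at time $k+1$ it dies and gives birth to exactly two particles $v1,v2$, which move independently to new locations $S_{v1},S_{v2}$; each increment $S_{vi}-S_v$ is independent of $S_v$ and is distributed as the centered normal $N(0,\sigma_1^2)$ if $k<n/2$ and as $N(0,\sigma_2^2)$ if $n/2\le k<n$. All increments attached to distinct particles are mutually independent. Let $\mathbb{D}_n$ be the set of the $2^n$ particles at time $n$. The maximal displacement is $M_n=\max_{v\in\mathbb{D}_n}S_v$; it is written $M_n^{\downarrow}$ when $\sigma_1^2>\sigma_2^2$. Note that the variance profile depends on $n$, so that for each $n$ a separate branching random walk is considered. Notation $O_P(1)$ (stochastic boundedness): a sequence of random variables $R_n$ satisfies $R_n=O_P(1)$ if for every $\epsilon>0$ there exists $M$ such that $P(|R_n|>M)<\epsilon$ for all $n$. An equation $M_n=a_n+O_P(1)$ means $M_n-a_n=O_P(1)$. Here $\log$ is the natural logarithm. *)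

theory Defs
  imports "HOL-Probability.Probability"
begin

(* A particle of generation k is coded by its ancestral line, a bool list of length k
   (root []); its two children are v @ [False] and v @ [True].  S v is the position of v.
   No constraint is put on S at lists longer than n. *)

definition step_sd :: "nat \<Rightarrow> real \<Rightarrow> real \<Rightarrow> nat \<Rightarrow> real" where
  "step_sd n \<sigma>\<^sub>1 \<sigma>\<^sub>2 k = (if real k < real n / 2 then \<sigma>\<^sub>1 else \<sigma>\<^sub>2)"

definition displacement :: "(bool list \<Rightarrow> 'a \<Rightarrow> real) \<Rightarrow> bool list \<times> bool \<Rightarrow> 'a \<Rightarrow> real" where
  "displacement S = (\<lambda>(v, i) \<omega>. S (v @ [i]) \<omega> - S v \<omega>)"

(* The parameters \<sigma>\<^sub>1, \<sigma>\<^sub>2 are standard deviations: normal_density \<mu> \<sigma> has variance \<sigma>\<^sup>2. *)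
locale two_variance_brw = prob_space M
  for M :: "'a measure" and n :: nat and \<sigma>\<^sub>1 \<sigma>\<^sub>2 :: real
    and S :: "bool list \<Rightarrow> 'a \<Rightarrow> real" +
  assumes start: "\<And>\<omega>. \<omega> \<in> space M \<Longrightarrow> S [] \<omega> = 0"
    and normal_steps: "\<And>v i. length v < n \<Longrightarrow>
      distributed M lborel (displacement S (v, i)) (normal_density 0 (step_sd n \<sigma>\<^sub>1 \<sigma>\<^sub>2 (length v)))"
    and indep_steps: "indep_vars (\<lambda>_. borel) (displacement S) {(v, i). length v < n}"

definition max_displacement :: "nat \<Rightarrow> (bool list \<Rightarrow> 'a \<Rightarrow> real) \<Rightarrow> 'a \<Rightarrow> real" where
  "max_displacement n S \<omega> = (MAX v\<in>{v. length v = n}. S v \<omega>)"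

(* R n = O_P(1) along n = 1, 2, ..., where R n may live on its own probability space M n.
   Measurability is required explicitly because measure is 0 on non-measurable sets. *)
definition stochastically_bounded :: "(nat \<Rightarrow> 'a measure) \<Rightarrow> (nat \<Rightarrow> 'a \<Rightarrow> real) \<Rightarrow> bool" where
  "stochastically_bounded M R \<longleftrightarrow>
     (\<forall>n\<ge>1. R n \<in> borel_measurable (M n)) \<and>
     (\<forall>\<epsilon>>0. \<exists>K. \<forall>n\<ge>1. measure (M n) {\<omega> \<in> space (M n). \<bar>R n \<omega>\<bar> > K} < \<epsilon>)"

end

theory Submission
  imports Defs "HOL-Real_Asymp.Real_Asymp"
begin

text \<open>
  The tail \<open>P(M > x)\<close> of the maximum is obtained from the indicator of the negative half line by iterating
  \<open>u \<mapsto> 1 - (1 - g * u)\<^sup>2\<close> with Gaussian kernels \<open>g\<close>, a monotone recursion. After an exponential change of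
  measure at the critical slope its linearization is the heat equation. The odd solutions
  \<open>y exp (- y\<^sup>2 / (2 t)) / t powr (3/2)\<close> yield explicit supersolutions above the logarithmically curved barrier,
  with bound \<open>1\<close> below it, and explicit subsolutions, via a second moment bound, along a straight line.
  Hence the homogeneous walk has its front at \<open>c n - 3 / (2 c) ln n + O(1)\<close> with \<open>c = sqrt (2 ln 2)\<close>.

  For decreasing variances the lower bound follows by taking the best particle at time \<open>n/2\<close> and its
  best descendant. For the upper bound, the tail of the second half decays at rate \<open>c / \<sigma>\<^sub>2\<close>, which
  exceeds the critical slope \<open>c / \<sigma>\<^sub>1\<close> of the first half; so it is an admissible initial condition for
  the supersolution of the first half, and the two logarithmic corrections add up.
\<close>

subsection \<open>Odd solutions of the heat equation\<close>

text \<open>At the critical slope two children exactly compensate the Gaussian cost of a step, so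
  the tilted first moment is a heat flow without growth. Without a barrier it decays like
  \<open>t powr (-1/2)\<close> and would give only the correction \<open>ln n / (2 c)\<close>. Below
  the barrier the trivial bound \<open>1\<close> is better than the first moment; using it there
  acts like absorption, which selects the odd solution and its extra factor \<open>1 / t\<close>.
  Since time is discrete, steps jump over the barrier, and the overshoot has to be paid for
  explicitly. The order of the variances decides why both corrections appear in full. Going down by
  \<open>y\<close> from the maximum at time \<open>n/2\<close> multiplies the number of particles by
  about \<open>exp (c * y / \<sigma>)\<close> with the first standard deviation, but costs the
  second half a factor \<open>exp (- c * y / \<sigma>')\<close> with the second. As the second rate
  is larger, only particles at bounded distance from that maximum matter. All estimates concern tail
  functions; probability enters only when the law of the maximum is identified with the
  recursion.\<close>

definition gauss_avg :: "(real \<Rightarrow> real) \<Rightarrow> real \<Rightarrow> real" where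
  "gauss_avg f x = (\<integral>y. std_normal_density y * f (x - y) \<partial>lborel)"

text \<open>For variance \<open>t\<close>, a solution of the heat equation that is odd, hence vanishes at \<open>0\<close>. It replaces
  ballot-type estimates for walks that are kept below a barrier: it decays like \<open>y / t powr (3/2)\<close>.\<close>

definition heat :: "real \<Rightarrow> real \<Rightarrow> real" where
  "heat t y = y * exp (- y\<^sup>2 / (2 * t)) / (t * sqrt t)"

lemma heat_measurable [measurable]: "heat t \<in> borel_measurable borel"
  unfolding heat_def by measurable

text \<open>\<open>heat t\<close> is \<open>- sqrt (2 * pi)\<close> times the derivative of the
  normal density of variance \<open>t\<close>, so a Gaussian step raises the variance by one.
  Completing the square leaves a normal density of mean \<open>z / (t + 1)\<close> and variance
  \<open>t / (t + 1)\<close>, against which the linear factor \<open>z - y\<close> is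
  averaged.\<close>

lemma has_integral_gauss_heat:
  assumes t: "t > 0"
  shows "has_bochner_integral lborel (\<lambda>y. std_normal_density y * heat t (z - y)) (heat (t + 1) z)"
proof -
  define s where "s = sqrt (t / (t + 1))"
  define m where "m = z / (t + 1)"
  have s: "s > 0" "s\<^sup>2 = t / (t + 1)" using t by (auto simp: s_def)
  define K where "K = exp (- z\<^sup>2 / (2 * (t + 1))) * s / (t * sqrt t)"
  have "has_bochner_integral lborel (\<lambda>y. K * (z * normal_density m s y - normal_density m s y * y)) (K * (z * 1 - m))"
    using s(1)
    by (intro has_bochner_integral_mult_right has_bochner_integral_diff normal_moment_nz_1)
       (auto simp: has_bochner_integral_iff)
  moreover have "K * (z * 1 - m) = heat (t + 1) z"
  proof -
    have 1: "z - m = z * t / (t + 1)" using t by (simp add: m_def field_simps)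
    have "sqrt t * sqrt t = t" using t by simp
    then show ?thesis unfolding 1 mult_1_right K_def heat_def s_def real_sqrt_divide
      using t by (simp add: divide_simps)
  qed
  moreover have "K * (z * normal_density m s y - normal_density m s y * y) = std_normal_density y * heat t (z - y)" for y
  proof -
    have e: "- y\<^sup>2 / 2 + - (z - y)\<^sup>2 / (2 * t) = - z\<^sup>2 / (2 * (t + 1)) + - (y - m)\<^sup>2 / (2 * s\<^sup>2)"
    proof -
      have "(t + 1) * (y - m) = y * (t + 1) - z"
        using t by (simp add: m_def algebra_simps add_divide_distrib[symmetric]) (simp add: field_simps)
      then have q: "(t + 1)\<^sup>2 * (y - m)\<^sup>2 = (y * (t + 1) - z)\<^sup>2"
        by (simp flip: power_mult_distrib)
      have "(y - m)\<^sup>2 / (2 * s\<^sup>2) = (y * (t + 1) - z)\<^sup>2 / (2 * t * (t + 1))"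
        using t unfolding s(2) q[symmetric] by (simp add: divide_simps) (simp add: power2_eq_square)
      also have "\<dots> + z\<^sup>2 / (2 * (t + 1)) = y\<^sup>2 / 2 + (z - y)\<^sup>2 / (2 * t)"
        using t by (simp add: divide_simps) (simp add: power2_eq_square algebra_simps)
      finally show ?thesis by (simp add: algebra_simps)
    qed
    have sq: "sqrt (2 * pi * s\<^sup>2) = sqrt (2 * pi) * s" unfolding real_sqrt_mult using s(1) by simp
    have "K * (z * normal_density m s y - normal_density m s y * y)
        = (exp (- z\<^sup>2 / (2 * (t + 1))) * exp (- (y - m)\<^sup>2 / (2 * s\<^sup>2))) * (z - y) / (t * sqrt t) / sqrt (2 * pi)"
      unfolding K_def normal_density_def sq using s t by (simp add: field_simps)
    also have "\<dots> = (exp (- y\<^sup>2 / 2) * exp (- (z - y)\<^sup>2 / (2 * t))) * (z - y) / (t * sqrt t) / sqrt (2 * pi)"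
      unfolding exp_add[symmetric] e ..
    also have "\<dots> = std_normal_density y * heat t (z - y)"
      unfolding std_normal_density_def heat_def by (simp add: mult_ac)
    finally show ?thesis .
  qed
  ultimately show ?thesis by simp
qed

lemma integrable_gauss_heat [simp, intro]:
  "t > 0 \<Longrightarrow> integrable lborel (\<lambda>y. std_normal_density y * heat t (z - y))"
  using has_integral_gauss_heat[of t z] by (simp add: has_bochner_integral_iff)

lemma gauss_avg_heat: "t > 0 \<Longrightarrow> gauss_avg (heat t) z = heat (t + 1) z"
  using has_integral_gauss_heat[of t z] by (simp add: has_bochner_integral_iff gauss_avg_def)

lemma integrable_gauss_bounded:
  fixes f :: "real \<Rightarrow> real"
  assumes [measurable]: "f \<in> borel_measurable borel" and "\<And>y. \<bar>f y\<bar> \<le> B"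
  shows "integrable lborel (\<lambda>y. std_normal_density y * f y)"
proof (rule Bochner_Integration.integrable_bound)
  show "integrable lborel (\<lambda>y. std_normal_density y * B)" by simp
  have "\<bar>f y\<bar> \<le> \<bar>B\<bar>" for y using assms(2)[of y] by linarith
  then show "AE y in lborel. norm (std_normal_density y * f y) \<le> norm (std_normal_density y * B)"
    by (auto simp: abs_mult intro!: mult_left_mono)
qed simp

lemma integrable_gauss_ind:
  assumes "integrable lborel (\<lambda>y. std_normal_density y * f y)"
  shows "integrable lborel (\<lambda>y. std_normal_density y * (indicator {z<..} y * f y))"
    "integrable lborel (\<lambda>y. std_normal_density y * (indicator {..z} y * f y))"
proof -
  show "integrable lborel (\<lambda>y. std_normal_density y * (indicator {z<..} y * f y))"
    using integrable_mult_indicator[of "{z<..}" lborel, OF _ assms] by (simp add: mult_ac)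
  show "integrable lborel (\<lambda>y. std_normal_density y * (indicator {..z} y * f y))"
    using integrable_mult_indicator[of "{..z}" lborel, OF _ assms] by (simp add: mult_ac)
qed

text \<open>Up to the indicator the integrand is the derivative of
  \<open>(y - z) * std_normal_density y\<close>, which vanishes at \<open>z\<close> and at
  infinity.\<close>

lemma gauss_tail_identity:
  fixes z :: real
  shows "has_bochner_integral lborel (\<lambda>y. std_normal_density y * (indicator {z<..} y * (1 - (y - z) * y))) 0"
proof -
  let ?f = "\<lambda>y. std_normal_density y * (1 - (y - z) * y)"
  let ?F = "\<lambda>y. (y - z) * std_normal_density y"
  have "integrable lborel (\<lambda>y. std_normal_density y - std_normal_density y * y ^ 2 + z * (std_normal_density y * y ^ 1))"
    by (intro Bochner_Integration.integrable_add Bochner_Integration.integrable_diff integrable_mult_right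
        integrable_std_normal_moment integrable_normal_density) auto
  then have int: "integrable lborel ?f"
    by (simp add: algebra_simps power2_eq_square)
  have si: "set_integrable lborel (einterval z \<infinity>) ?f"
    unfolding set_integrable_def using int by (intro integrable_mult_indicator) auto
  have tend: "(?F \<longlongrightarrow> 0) at_top"
    unfolding std_normal_density_def by real_asymp
  have "(LBINT y=z..\<infinity>. ?f y) = 0 - ?F z"
  proof (rule interval_integral_FTC_integrable)
    show "(?F has_vector_derivative ?f y) (at y)" for y
      unfolding std_normal_density_def has_real_derivative_iff_has_vector_derivative[symmetric]
      by (rule derivative_eq_intros refl | simp)+ (simp add: algebra_simps power2_eq_square add_divide_distrib diff_divide_distrib)
    show "isCont ?f y" for y
      unfolding std_normal_density_def by (intro continuous_intros) auto
    show "((?F \<circ> real_of_ereal) \<longlongrightarrow> ?F z) (at_right (ereal z))"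
      unfolding ereal_tendsto_simps
      unfolding std_normal_density_def by (intro tendsto_intros) auto
    show "((?F \<circ> real_of_ereal) \<longlongrightarrow> 0) (at_left \<infinity>)"
      unfolding ereal_tendsto_simps by (rule tend)
  qed (use si in auto)
  then have "(LINT y|lborel. indicator {z<..} y * ?f y) = 0"
    by (simp add: interval_lebesgue_integral_def set_lebesgue_integral_def)
  then show ?thesis
    using integrable_mult_indicator[of "{z<..}" lborel, OF _ int]
    by (simp add: has_bochner_integral_iff mult_ac)
qed

text \<open>With \<open>r = y - z\<close> and \<open>z \<ge> -1/2\<close>, the quadratic \<open>1 - r\<^sup>2 + r/2\<close> dominates the integrand \<open>1 - (y - z) * y\<close>
  of \<open>gauss_tail_identity\<close>, whose Gaussian tail integral vanishes. This avoids estimating partial Gaussian moments.\<close>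

lemma heat_pointwise:
  assumes "t \<ge> 25" "r \<ge> 0"
  shows "2 - r\<^sup>2 + r / 2 \<le> t * sqrt t * heat t (5 - r)"
proof -
  have eq: "t * sqrt t * heat t (5 - r) = (5 - r) * exp (- (5 - r)\<^sup>2 / (2 * t))"
    using assms by (simp add: heat_def)
  show ?thesis
  proof (cases "r \<le> 5")
    case True
    \<comment> \<open>For \<open>r \<le> 5\<close> and \<open>t \<ge> 25\<close> the exponent is at
      least \<open>-1/2\<close>, so half of \<open>5 - r\<close> survives. For \<open>r > 5\<close>
      the profile is negative and bounding the exponential by \<open>1\<close> is enough.\<close>
    have "(5 - r)\<^sup>2 \<le> 25" using True assms by (intro order_trans[OF power_mono[of "5-r" 5 2]]) auto
    then have "(5 - r)\<^sup>2 / (2 * t) \<le> 1 / 2" using assms by (simp add: field_simps)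
    then have "exp (- (5 - r)\<^sup>2 / (2 * t)) \<ge> 1 - 1/2"
      using exp_ge_add_one_self[of "- (5 - r)\<^sup>2 / (2 * t)"] by simp
    then have "(5 - r) * exp (- (5 - r)\<^sup>2 / (2 * t)) \<ge> (5 - r) * (1/2)"
      using True by (intro mult_left_mono) auto
    moreover have "2 - r\<^sup>2 + r / 2 \<le> (5 - r) * (1/2)"
      using sum_squares_ge_zero[of "r - 1/2" 0] by (simp add: power2_eq_square algebra_simps)
    ultimately show ?thesis unfolding eq by simp
  next
    case False
    have "exp (- (5 - r)\<^sup>2 / (2 * t)) \<le> 1" using assms by simp
    then have "(5 - r) * exp (- (5 - r)\<^sup>2 / (2 * t)) \<ge> (5 - r) * 1"
      using False by (intro mult_left_mono_neg) auto
    moreover have "2 - r\<^sup>2 + r / 2 \<le> 5 - r"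
      using sum_squares_ge_zero[of "r - 3/4" 0] by (simp add: power2_eq_square algebra_simps)
    ultimately show ?thesis unfolding eq by simp
  qed
qed

text \<open>The mass that enters from below the barrier is positive once the zero of the heat profile is moved
  five units below the barrier; the shifted profile is then a supersolution for the walk killed at
  integer times, and a multiple of it absorbs boundary values below the barrier.\<close>

lemma gauss_heat_tail:
  assumes t: "t \<ge> 25" and z: "z \<ge> -1/2"
  shows "(\<integral>y. std_normal_density y * indicator {z<..} y \<partial>lborel)
    \<le> t * sqrt t * (\<integral>y. std_normal_density y * (indicator {z<..} y * heat t (z - y + 5)) \<partial>lborel)"
proof -
  have i1: "integrable lborel (\<lambda>y. std_normal_density y * (indicator {z<..} y * 1))"
    by (rule integrable_gauss_ind) simp
  have i2: "integrable lborel (\<lambda>y. std_normal_density y * (indicator {z<..} y * heat t (z - y + 5)))"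
    by (rule integrable_gauss_ind) (use integrable_gauss_heat[of t "z + 5"] t in \<open>simp add: algebra_simps\<close>)
  note i3 = gauss_tail_identity[of z]
  \<comment> \<open>Adding the null integral costs nothing; its leading \<open>1\<close> and the
    integrand \<open>1\<close> make up the \<open>2\<close> in
    \<open>heat_pointwise\<close>.\<close>
  have "(\<integral>y. std_normal_density y * indicator {z<..} y \<partial>lborel)
      = (\<integral>y. std_normal_density y * (indicator {z<..} y * 1) + std_normal_density y * (indicator {z<..} y * (1 - (y - z) * y)) \<partial>lborel)"
    using i1 i3 by (subst Bochner_Integration.integral_add) (auto simp: has_bochner_integral_iff)
  also have "\<dots> \<le> (\<integral>y. t * sqrt t * (std_normal_density y * (indicator {z<..} y * heat t (z - y + 5))) \<partial>lborel)"
  proof (rule integral_mono)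
    fix y
    have "1 + (1 - (y - z) * y) \<le> t * sqrt t * heat t (z - y + 5)" if "y > z"
    proof -
      have "(y - z) * (-1/2) \<le> (y - z) * z" using that z by (intro mult_left_mono) auto
      then have "1 + (1 - (y - z) * y) \<le> 2 - (y - z)\<^sup>2 + (y - z) / 2"
        by (simp add: power2_eq_square algebra_simps)
      then show ?thesis using heat_pointwise[OF t, of "y - z"] that by (simp add: algebra_simps)
    qed
    then have "std_normal_density y * (indicator {z<..} y * (1 + (1 - (y - z) * y)))
        \<le> std_normal_density y * (indicator {z<..} y * (t * sqrt t * heat t (z - y + 5)))"
      by (cases "z < y") (auto intro: mult_left_mono)
    then show "std_normal_density y * (indicator {z<..} y * 1) + std_normal_density y * (indicator {z<..} y * (1 - (y - z) * y))
       \<le> t * sqrt t * (std_normal_density y * (indicator {z<..} y * heat t (z - y + 5)))"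
      by (simp add: algebra_simps)
  qed (use i1 i2 i3 in \<open>auto simp: has_bochner_integral_iff\<close>)
  also have "\<dots> = t * sqrt t * (\<integral>y. std_normal_density y * (indicator {z<..} y * heat t (z - y + 5)) \<partial>lborel)"
    by simp
  finally show ?thesis .
qed

subsection \<open>The branching recursion\<close>

text \<open>If \<open>u x\<close> is the probability that a branching random walk ends above \<open>x\<close>, then \<open>branch \<sigma> u\<close> is this
  probability after one more generation is put in front.\<close>

definition branch :: "real \<Rightarrow> (real \<Rightarrow> real) \<Rightarrow> real \<Rightarrow> real" where
  "branch \<sigma> u x = 1 - (1 - (\<integral>y. std_normal_density y * u (x - \<sigma> * y) \<partial>lborel))\<^sup>2"

definition tail_fun :: "(real \<Rightarrow> real) \<Rightarrow> bool" where
  "tail_fun u \<longleftrightarrow> u \<in> borel_measurable borel \<and> (\<forall>x. 0 \<le> u x \<and> u x \<le> 1)"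

lemma tail_funD:
  assumes "tail_fun u"
  shows "u \<in> borel_measurable borel" "0 \<le> u x" "u x \<le> 1"
  using assms by (auto simp: tail_fun_def)

lemma tail_fun_integrable:
  assumes "tail_fun u"
  shows "integrable lborel (\<lambda>y. std_normal_density y * u (x - \<sigma> * y))"
proof -
  note [measurable] = tail_funD(1)[OF assms]
  show ?thesis
    by (rule integrable_gauss_bounded[where B=1]) (use tail_funD[OF assms] in auto)
qed

lemma tail_fun_avg:
  assumes "tail_fun u"
  shows "0 \<le> (\<integral>y. std_normal_density y * u (x - \<sigma> * y) \<partial>lborel)"
    "(\<integral>y. std_normal_density y * u (x - \<sigma> * y) \<partial>lborel) \<le> 1"
proof -
  show "0 \<le> (\<integral>y. std_normal_density y * u (x - \<sigma> * y) \<partial>lborel)"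
    using tail_funD[OF assms] by (intro integral_nonneg_AE) auto
  have "(\<integral>y. std_normal_density y * u (x - \<sigma> * y) \<partial>lborel) \<le> (\<integral>y. std_normal_density y * 1 \<partial>lborel)"
    using tail_funD[OF assms]
    by (intro integral_mono tail_fun_integrable[OF assms] mult_left_mono) auto
  then show "(\<integral>y. std_normal_density y * u (x - \<sigma> * y) \<partial>lborel) \<le> 1" by simp
qed

lemma tail_fun_branch:
  assumes "tail_fun u"
  shows "tail_fun (branch \<sigma> u)"
proof -
  note [measurable] = tail_funD(1)[OF assms]
  have "branch \<sigma> u \<in> borel_measurable borel" unfolding branch_def by measurable
  moreover have "0 \<le> branch \<sigma> u x" "branch \<sigma> u x \<le> 1" for x
    unfolding branch_def using tail_fun_avg[OF assms, of x \<sigma>] by (simp_all add: power_le_one)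
  ultimately show ?thesis by (auto simp: tail_fun_def)
qed

lemma tail_fun_funpow: "tail_fun u \<Longrightarrow> tail_fun ((branch \<sigma> ^^ k) u)"
  by (induction k) (auto intro: tail_fun_branch)

lemma one_minus_sq_mono: "p \<le> q \<Longrightarrow> q \<le> 1 \<Longrightarrow> 1 - (1 - p)\<^sup>2 \<le> 1 - (1 - q)\<^sup>2" for p q :: real
  by (simp add: power_mono)

lemma branch_mono:
  assumes u: "tail_fun u" and v: "tail_fun v" and le: "\<And>x. u x \<le> v x"
  shows "branch \<sigma> u x \<le> branch \<sigma> v x"
  unfolding branch_def
  by (intro one_minus_sq_mono integral_mono tail_fun_integrable u v mult_left_mono le tail_fun_avg) auto

lemma branch_funpow_mono:
  assumes u: "tail_fun u" and v: "tail_fun v" and le: "\<And>x. u x \<le> v x"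
  shows "(branch \<sigma> ^^ k) u x \<le> (branch \<sigma> ^^ k) v x"
  by (induction k arbitrary: x) (auto intro!: le branch_mono tail_fun_funpow u v)

text \<open>Measuring space in units of \<open>\<sigma>\<close> reduces all estimates to unit
  variance.\<close>

lemma branch_funpow_scale: "(branch \<sigma> ^^ k) u (\<sigma> * x) = (branch 1 ^^ k) (\<lambda>x. u (\<sigma> * x)) x"
  by (induction k arbitrary: x) (simp_all add: branch_def flip: right_diff_distrib)

lemma branch_funpow_shift: "(branch \<sigma> ^^ k) (\<lambda>x. u (x + a)) x = (branch \<sigma> ^^ k) u (x + a)"
  by (induction k arbitrary: x) (simp_all add: branch_def algebra_simps)

lemma tail_fun_scale: "tail_fun u \<Longrightarrow> tail_fun (\<lambda>x. u (a * x + b))"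
  unfolding tail_fun_def by (auto intro!: measurable_compose[of "\<lambda>x. a * x + b" borel borel u])

lemma branch_1: "branch 1 u x = 1 - (1 - gauss_avg u x)\<^sup>2"
  by (simp add: branch_def gauss_avg_def)

text \<open>Exponential change of measure: substitute \<open>y = s + h\<close> and expand the square
  in the density.\<close>

lemma gauss_avg_tilt:
  "gauss_avg f x = exp (- s\<^sup>2 / 2) * (\<integral>h. std_normal_density h * (exp (- s * h) * f (x - s - h)) \<partial>lborel)"
proof -
  have "gauss_avg f x = (\<integral>h. std_normal_density (s + h) * f (x - (s + h)) \<partial>lborel)"
    unfolding gauss_avg_def by (subst lborel_integral_real_affine[of 1 _ s]) auto
  also have "\<dots> = (\<integral>h. exp (- s\<^sup>2 / 2) * (std_normal_density h * (exp (- s * h) * f (x - s - h))) \<partial>lborel)"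
  proof (intro Bochner_Integration.integral_cong refl)
    fix h
    have "std_normal_density (s + h) = exp (- s\<^sup>2 / 2) * std_normal_density h * exp (- s * h)"
      unfolding std_normal_density_def
      by (simp add: exp_add[symmetric]) (simp add: field_simps power2_eq_square)
    then show "std_normal_density (s + h) * f (x - (s + h))
        = exp (- s\<^sup>2 / 2) * (std_normal_density h * (exp (- s * h) * f (x - s - h)))"
      by (simp add: diff_diff_eq mult.assoc)
  qed
  finally show ?thesis by simp
qed

subsection \<open>Supersolutions\<close>

definition crit :: real where "crit = sqrt (2 * ln 2)"

lemma crit_sq: "crit\<^sup>2 = 2 * ln 2" and crit_pos: "crit > 0"
  by (auto simp: crit_def)

text \<open>Mean offspring times the Gaussian cost of a step of size \<open>crit\<close>. That the
  product is one makes \<open>crit\<close> the speed.\<close>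

lemma exp_crit: "2 * exp (- crit\<^sup>2 / 2) = 1"
  by (simp add: crit_sq exp_minus)

text \<open>The union bound \<open>1 - (1 - p)\<^sup>2 \<le> 2 * p\<close>, then the tilt at
  \<open>crit\<close>. Steps \<open>h > z\<close> come from below the barrier, where only
  \<open>u \<le> 1\<close> is known; by \<open>tail\<close>, the values of \<open>\<Lambda>\<close>
  at negative arguments pay for them. The parameter \<open>l\<close> will be
  \<open>barrier k\<close>.\<close>

lemma branch_upper_step:
  assumes u: "tail_fun u"
    and bound: "\<And>y. y \<ge> 0 \<Longrightarrow> u (X + y) \<le> exp (- crit * (y - l)) * \<Lambda> y"
    and int: "integrable lborel (\<lambda>h. std_normal_density h * \<Lambda> (z - h))"
    and tail: "exp (- crit * l) * (\<integral>h. std_normal_density h * indicator {z<..} h \<partial>lborel)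
      \<le> (\<integral>h. std_normal_density h * (indicator {z<..} h * \<Lambda> (z - h)) \<partial>lborel)"
  shows "branch 1 u (X + crit + z) \<le> exp (- crit * (z - l)) * gauss_avg \<Lambda> z"
proof -
  let ?E = "exp (- crit * (z - l))"
  let ?I = "\<lambda>A f. (\<integral>h. std_normal_density h * (indicator A h * f h) \<partial>lborel)"
  have i1: "integrable lborel (\<lambda>h. std_normal_density h * (indicator {..z} h * \<Lambda> (z - h)))"
    and i2: "integrable lborel (\<lambda>h. std_normal_density h * (indicator {z<..} h * \<Lambda> (z - h)))"
    using integrable_gauss_ind[OF int] by auto
  have i3: "integrable lborel (\<lambda>h. std_normal_density h * (indicator {z<..} h * 1))"
    by (rule integrable_gauss_ind) simp
  define f where "f h = ?E * (std_normal_density h * (indicator {..z} h * \<Lambda> (z - h)))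
      + exp (- crit * z) * (std_normal_density h * (indicator {z<..} h * 1))" for h
  have pt: "std_normal_density h * (exp (- crit * h) * u (X + z - h)) \<le> f h" for h
  proof (cases "h \<le> z")
    case True
    have "exp (- crit * h) * u (X + (z - h)) \<le> exp (- crit * h) * (exp (- crit * (z - h - l)) * \<Lambda> (z - h))"
      using bound[of "z - h"] True by (intro mult_left_mono) auto
    also have "\<dots> = ?E * \<Lambda> (z - h)"
      unfolding mult.assoc[symmetric] exp_add[symmetric] by (simp add: algebra_simps)
    finally have "exp (- crit * h) * u (X + z - h) \<le> ?E * \<Lambda> (z - h)" by (simp add: algebra_simps)
    then have "std_normal_density h * (exp (- crit * h) * u (X + z - h)) \<le> std_normal_density h * (?E * \<Lambda> (z - h))"
      by (rule mult_left_mono) simp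
    then show ?thesis using True by (simp add: f_def algebra_simps)
  next
    case False
    have "exp (- crit * h) * u (X + z - h) \<le> exp (- crit * z) * 1"
      using False crit_pos tail_funD[OF u] by (intro mult_mono) auto
    then have "std_normal_density h * (exp (- crit * h) * u (X + z - h)) \<le> std_normal_density h * (exp (- crit * z) * 1)"
      by (rule mult_left_mono) simp
    then show ?thesis using False by (simp add: f_def algebra_simps)
  qed
  have "branch 1 u (X + crit + z) \<le> 2 * gauss_avg u (X + crit + z)"
    unfolding branch_1 by (simp add: power2_eq_square algebra_simps)
  also have "\<dots> = (\<integral>h. std_normal_density h * (exp (- crit * h) * u (X + z - h)) \<partial>lborel)"
    unfolding gauss_avg_tilt[of u _ crit] mult.assoc[symmetric] exp_crit by (simp add: algebra_simps)
  also have "\<dots> \<le> (\<integral>h. f h \<partial>lborel)"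
  proof (rule integral_mono')
    show "integrable lborel f" unfolding f_def using i1 i3 by simp
    show "0 \<le> f h" for h
      by (rule order_trans[OF _ pt[of h]]) (use tail_funD[OF u] in auto)
  qed (rule pt)
  also have "\<dots> = ?E * ?I {..z} (\<lambda>h. \<Lambda> (z - h)) + exp (- crit * z) * ?I {z<..} (\<lambda>_. 1)"
    unfolding f_def using i1 i3 by simp
  also have "exp (- crit * z) * ?I {z<..} (\<lambda>_. 1) = ?E * (exp (- crit * l) * ?I {z<..} (\<lambda>_. 1))"
    unfolding mult.assoc[symmetric] exp_add[symmetric] by (simp add: algebra_simps)
  also have "\<dots> \<le> ?E * ?I {z<..} (\<lambda>h. \<Lambda> (z - h))"
    using tail by (intro mult_left_mono) auto
  also have "?E * ?I {..z} (\<lambda>h. \<Lambda> (z - h)) + \<dots>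
      = ?E * (\<integral>h. std_normal_density h * (indicator {..z} h * \<Lambda> (z - h)) + std_normal_density h * (indicator {z<..} h * \<Lambda> (z - h)) \<partial>lborel)"
    using i1 i2 by (simp add: distrib_left)
  also have "\<dots> = ?E * gauss_avg \<Lambda> z"
    unfolding gauss_avg_def
    by (intro arg_cong[where f="\<lambda>x. ?E * x"] Bochner_Integration.integral_cong) (auto split: split_indicator)
  finally show ?thesis by simp
qed

text \<open>The barrier moves by \<open>O(1/k)\<close> at step \<open>k\<close>, which is harmful at distances beyond \<open>sqrt k\<close>. Inflating the
  variance by the summable factors \<open>1 + decay k\<close> makes up for it (\<open>heat_shift\<close>) at the price of a
  bounded constant.\<close>

definition decay :: "nat \<Rightarrow> real" where "decay k = 1 / ((real k + 3) * sqrt (real k + 3))"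

lemma decay_pos: "decay k > 0" by (simp add: decay_def)

lemma summable_decay: "summable decay"
proof (rule summable_comparison_test_bigo)
  show "summable (\<lambda>n. norm (real n powr (-3/2)))" by (simp add: summable_real_powr_iff)
  show "decay \<in> O(\<lambda>n. real n powr (-3/2))" unfolding decay_def by real_asymp
qed

definition decay_sum :: "nat \<Rightarrow> real" where "decay_sum k = (\<Sum>j<k. decay j)"

definition decay_total :: real where "decay_total = suminf decay"

lemma decay_sum_le: "0 \<le> decay_sum k" "decay_sum k \<le> decay_total"
proof -
  show "0 \<le> decay_sum k" unfolding decay_sum_def using decay_pos by (intro sum_nonneg less_imp_le) auto
  show "decay_sum k \<le> decay_total" unfolding decay_sum_def decay_total_def
    using decay_pos by (intro sum_le_suminf summable_decay) (auto intro: less_imp_le)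
qed

fun spread :: "real \<Rightarrow> nat \<Rightarrow> real" where
  "spread t 0 = t"
| "spread t (Suc k) = (1 + decay k) * (spread t k + 1)"

lemma spread_ge: "t \<ge> 0 \<Longrightarrow> t + real k \<le> spread t k"
proof (induction k)
  case (Suc k)
  have "t + real (Suc k) \<le> 1 * (spread t k + 1)" using Suc by simp
  also have "\<dots> \<le> (1 + decay k) * (spread t k + 1)"
    using Suc decay_pos[of k] by (intro mult_right_mono) auto
  finally show ?case by simp
qed simp

text \<open>The inflation factors multiply to a bounded constant, so the variance stays comparable
  with \<open>t + k\<close> and the profile keeps its order of decay.\<close>

lemma spread_le: "t \<ge> 0 \<Longrightarrow> spread t k \<le> exp (decay_sum k) * (t + real k)"
proof (induction k)
  case (Suc k)
  have "spread t (Suc k) \<le> exp (decay k) * (exp (decay_sum k) * (t + real k) + exp (decay_sum k) * 1)"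
    unfolding spread.simps using Suc decay_pos[of k] spread_ge[of t k] decay_sum_le(1)[of k]
    by (intro mult_mono add_mono) (auto simp: exp_ge_add_one_self)
  also have "\<dots> = exp (decay_sum (Suc k)) * (t + real (Suc k))"
    by (simp add: decay_sum_def exp_add algebra_simps)
  finally show ?case .
qed (simp add: decay_sum_def)

text \<open>By \<open>(y + d)\<^sup>2 \<le> (1 + e) * (y\<^sup>2 + d\<^sup>2 / e)\<close>, a
  variance larger by the factor \<open>1 + e\<close> absorbs the shift in the Gaussian factor. The
  prefactor changes by \<open>(1 + e) powr (3/2)\<close>, at most
  \<open>exp (3 / 2 * e)\<close>.\<close>

lemma heat_shift:
  assumes "y \<ge> 0" "d \<ge> 0" "e > 0" "t > 0"
  shows "heat t y \<le> exp (3 / 2 * e + d\<^sup>2 / (2 * t * e)) * heat ((1 + e) * t) (y + d)"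
proof -
  have "0 \<le> (e * y - d)\<^sup>2" by simp
  then have "e * (y + d)\<^sup>2 \<le> (1 + e) * (e * y\<^sup>2 + d\<^sup>2)"
    by (simp add: power2_eq_square algebra_simps)
  then have "(y + d)\<^sup>2 / (2 * ((1 + e) * t)) \<le> y\<^sup>2 / (2 * t) + d\<^sup>2 / (2 * t * e)"
    using assms by (simp add: divide_simps) (simp add: algebra_simps)
  then have 1: "exp (- y\<^sup>2 / (2 * t)) \<le> exp (d\<^sup>2 / (2 * t * e)) * exp (- (y + d)\<^sup>2 / (2 * ((1 + e) * t)))"
    by (simp add: exp_add[symmetric])
  have "(1 + e) * sqrt (1 + e) \<le> exp e * exp (e / 2)"
  proof (rule mult_mono)
    have "sqrt (1 + e) \<le> sqrt (exp e)" by (simp add: exp_ge_add_one_self)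
    also have "sqrt (exp e) = exp (e / 2)"
      by (rule real_sqrt_unique) (simp_all add: power2_eq_square exp_add[symmetric])
    finally show "sqrt (1 + e) \<le> exp (e / 2)" .
  qed (use assms exp_ge_add_one_self[of e] in auto)
  then have 2: "(1 + e) * sqrt (1 + e) \<le> exp (3 / 2 * e)"
    by (simp add: exp_add[symmetric])
  have "heat t y \<le> (y + d) * (exp (d\<^sup>2 / (2 * t * e)) * exp (- (y + d)\<^sup>2 / (2 * ((1 + e) * t)))) / (t * sqrt t)"
    unfolding heat_def using assms 1 by (intro divide_right_mono mult_mono) auto
  also have "\<dots> = ((1 + e) * sqrt (1 + e)) * (exp (d\<^sup>2 / (2 * t * e)) * heat ((1 + e) * t) (y + d))"
    unfolding heat_def real_sqrt_mult using assms by (simp add: divide_simps)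
  also have "\<dots> \<le> exp (3 / 2 * e) * (exp (d\<^sup>2 / (2 * t * e)) * heat ((1 + e) * t) (y + d))"
    using assms by (intro mult_right_mono 2) (auto simp: heat_def)
  finally show ?thesis by (simp add: exp_add mult.assoc)
qed

lemma heat_le: "t > 0 \<Longrightarrow> y \<ge> 0 \<Longrightarrow> heat t y \<le> y / (t * sqrt t)"
  unfolding heat_def by (intro divide_right_mono) (auto intro: mult_left_le)

lemma heat_nonneg: "t > 0 \<Longrightarrow> y \<ge> 0 \<Longrightarrow> 0 \<le> heat t y"
  by (simp add: heat_def)

section \<open>The logarithmic barrier and heat profiles adapted to its motion\<close>

definition barrier :: "nat \<Rightarrow> real" where "barrier k = 3 / (2 * crit) * ln (real k + 3)"

lemma ln2_ge: "ln 2 \<ge> (9 / 16 :: real)"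
  using ln2_ge_two_thirds by simp

text \<open>The coefficient \<open>3 / (2 * crit)\<close> of the barrier is chosen for this: the
  exponential weight at the barrier cancels the decay \<open>(k + 3) powr (-3/2)\<close> of the heat
  profile.\<close>

lemma exp_barrier: "exp (crit * barrier k) = 1 / decay k"
proof -
  have "crit * barrier k = ln (real k + 3) + ln (real k + 3) / 2"
    using crit_pos by (simp add: barrier_def field_simps)
  then have "exp (crit * barrier k) = (real k + 3) * exp (ln (real k + 3) / 2)"
    by (simp only: exp_add) simp
  also have "exp (ln (real k + 3) / 2) = sqrt (real k + 3)"
    by (rule real_sqrt_unique[symmetric]) (simp_all add: power2_eq_square exp_add[symmetric])
  finally show ?thesis by (simp add: decay_def)
qed

text \<open>The bound \<open>1 / 2\<close>, valid from \<open>k = 0\<close> on thanks to the offset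
  \<open>3\<close>, keeps arguments in the range \<open>z \<ge> -1/2\<close> of the tail estimate.
  The quadratic bound makes the cost of the shift in \<open>heat_shift\<close> at most
  \<open>decay k\<close>.\<close>

lemma barrier_step:
  defines "d k \<equiv> barrier (Suc k) - barrier k"
  shows "0 \<le> d k" "d k \<le> 1 / 2" "(d k)\<^sup>2 \<le> 2 / (real k + 3)\<^sup>2"
proof -
  define N where "N = real k + 3"
  have N: "N \<ge> 3" by (simp add: N_def)
  have d: "d k = 3 / (2 * crit) * ln (1 + 1 / N)"
  proof -
    have "1 + 1 / N = (N + 1) / N" using N by (simp add: field_simps)
    then have "ln (1 + 1 / N) = ln (N + 1) - ln N"
      using N by (simp add: ln_div)
    then show ?thesis by (simp add: d_def barrier_def N_def right_diff_distrib)
  qed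
  show 0: "0 \<le> d k" unfolding d using N crit_pos by (intro mult_nonneg_nonneg ln_ge_zero) auto
  have "d k \<le> 3 / (2 * crit) * (1 / N)" unfolding d
    using crit_pos N by (intro mult_left_mono ln_add_one_self_le_self) auto
  then have "(d k)\<^sup>2 \<le> (3 / (2 * crit) * (1 / N))\<^sup>2" using 0 by (intro power_mono)
  also have "\<dots> = 9 / (8 * ln 2) / N\<^sup>2"
    unfolding power_mult_distrib power_divide crit_sq by simp
  \<comment> \<open>\<open>9 / (8 * ln 2) \<le> 2\<close> amounts to
    \<open>ln 2 \<ge> 9 / 16\<close>.\<close>
  also have "\<dots> \<le> 2 / N\<^sup>2"
    using ln2_ge by (intro divide_right_mono) (auto simp: field_simps)
  finally show 1: "(d k)\<^sup>2 \<le> 2 / (real k + 3)\<^sup>2" by (simp add: N_def)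
  also have "\<dots> \<le> 2 / 3\<^sup>2" using N by (intro divide_left_mono power_mono) (auto simp: N_def)
  also have "\<dots> \<le> (1/2)\<^sup>2" by (simp add: power2_eq_square)
  finally show "d k \<le> 1 / 2" by (rule power2_le_imp_le) simp
qed

text \<open>The argument \<open>y\<close> is the distance from the barrier. Of the exponent
  \<open>5 / 2\<close>, a part \<open>3 / 2\<close> comes from inflating the variance and
  \<open>1\<close> from the shift of the barrier.\<close>

definition heat_comp :: "real \<Rightarrow> nat \<Rightarrow> real \<Rightarrow> real" where
  "heat_comp t k y = exp (5 / 2 * decay_sum k) * heat (spread t k) (y + 5)"

lemma heat_comp_integrable:
  assumes "t \<ge> 25"
  shows "integrable lborel (\<lambda>h. std_normal_density h * heat_comp t k (z - h))"
proof -
  have "spread t k > 0" using spread_ge[of t k] assms by simp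
  from integrable_mult_right[OF integrable_gauss_heat[OF this, of "z + 5"], of "exp (5 / 2 * decay_sum k)"]
  show ?thesis by (simp add: heat_comp_def algebra_simps)
qed

lemma heat_comp_step:
  assumes "t \<ge> 25" "z \<ge> - 1/2"
  shows "gauss_avg (heat_comp t k) z \<le> heat_comp t (Suc k) (z + (barrier (Suc k) - barrier k))"
proof -
  define d where "d = barrier (Suc k) - barrier k"
  have tk: "spread t k \<ge> t + real k" using spread_ge[of t k] assms by simp
  have "gauss_avg (heat_comp t k) z = exp (5 / 2 * decay_sum k) * gauss_avg (heat (spread t k)) (z + 5)"
    unfolding gauss_avg_def heat_comp_def by (simp add: algebra_simps flip: integral_mult_right_zero)
  also have "gauss_avg (heat (spread t k)) (z + 5) = heat (spread t k + 1) (z + 5)"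
    using tk assms by (intro gauss_avg_heat) auto
  finally have 1: "gauss_avg (heat_comp t k) z = exp (5 / 2 * decay_sum k) * heat (spread t k + 1) (z + 5)" .
  have "heat (spread t k + 1) (z + 5) \<le> exp (3 / 2 * decay k + d\<^sup>2 / (2 * (spread t k + 1) * decay k)) * heat ((1 + decay k) * (spread t k + 1)) (z + 5 + d)"
    using assms tk decay_pos barrier_step[of k] by (intro heat_shift) (auto simp: d_def)
  also have "\<dots> \<le> exp (5 / 2 * decay k) * heat ((1 + decay k) * (spread t k + 1)) (z + 5 + d)"
  proof (intro mult_right_mono)
    define N where "N = real k + 3"
    have N: "N \<ge> 3" by (simp add: N_def)
    \<comment> \<open>With \<open>d\<^sup>2 \<le> 2 / N\<^sup>2\<close>, variance at least
      \<open>N\<close> and \<open>decay k = N powr (-3/2)\<close>, the cost is at most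
      \<open>N powr (-3) / decay k = decay k\<close>.\<close>
    have "d\<^sup>2 / (2 * (spread t k + 1) * decay k) \<le> (2 / N\<^sup>2) / (2 * N * decay k)"
      using barrier_step(3)[of k] tk assms decay_pos[of k]
      by (intro frac_le mult_right_mono) (auto simp: d_def N_def)
    also have "\<dots> = 1 / (N ^ 3) / decay k" using N decay_pos[of k] by (simp add: field_simps power3_eq_cube power2_eq_square)
    also have "1 / (N ^ 3) = decay k * decay k"
      using N by (simp add: decay_def N_def[symmetric] power3_eq_cube)
    finally have "d\<^sup>2 / (2 * (spread t k + 1) * decay k) \<le> decay k" using decay_pos[of k] by simp
    then have "3 / 2 * decay k + d\<^sup>2 / (2 * (spread t k + 1) * decay k) \<le> 5 / 2 * decay k" by linarith
    then show "exp (3 / 2 * decay k + d\<^sup>2 / (2 * (spread t k + 1) * decay k)) \<le> exp (5 / 2 * decay k)"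
      by (simp only: exp_le_cancel_iff)
    show "0 \<le> heat ((1 + decay k) * (spread t k + 1)) (z + 5 + d)"
      using assms tk decay_pos[of k] barrier_step[of k] by (intro heat_nonneg mult_pos_pos) (auto simp: d_def)
  qed
  finally have "gauss_avg (heat_comp t k) z \<le> exp (5 / 2 * decay_sum k) *
      (exp (5 / 2 * decay k) * heat ((1 + decay k) * (spread t k + 1)) (z + 5 + d))"
    unfolding 1 by (rule mult_left_mono) simp
  also have "\<dots> = exp (5 / 2 * decay_sum (Suc k)) * heat ((1 + decay k) * (spread t k + 1)) (z + 5 + d)"
    by (simp add: decay_sum_def exp_add[symmetric] distrib_left)
  finally show ?thesis
    by (simp add: heat_comp_def d_def add_ac)
qed

lemma heat_comp_tail:
  assumes "t \<ge> 25" "z \<ge> - 1/2"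
  shows "1 / (spread t k * sqrt (spread t k)) * (\<integral>h. std_normal_density h * indicator {z<..} h \<partial>lborel)
    \<le> (\<integral>h. std_normal_density h * (indicator {z<..} h * heat_comp t k (z - h)) \<partial>lborel)"
proof -
  have tk: "spread t k \<ge> 25" using spread_ge[of t k] assms by simp
  let ?G = "\<integral>h. std_normal_density h * indicator {z<..} h \<partial>lborel"
  let ?H = "\<integral>y. std_normal_density y * (indicator {z<..} y * heat (spread t k) (z - y + 5)) \<partial>lborel"
  have G: "?G \<ge> 0" by (intro integral_nonneg_AE) auto
  have "?G \<le> spread t k * sqrt (spread t k) * ?H" by (rule gauss_heat_tail[OF tk assms(2)])
  then have "1 / (spread t k * sqrt (spread t k)) * ?G \<le> ?H" using tk by (simp add: field_simps)
  moreover have "?H \<ge> 0" using G calculation tk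
    by (smt (verit) divide_nonneg_nonneg mult_nonneg_nonneg real_sqrt_ge_zero)
  then have "?H \<le> exp (5 / 2 * decay_sum k) * ?H"
    using decay_sum_le(1)[of k] by (simp add: mult_le_cancel_right1)
  moreover have "exp (5 / 2 * decay_sum k) * ?H = (\<integral>h. std_normal_density h * (indicator {z<..} h * heat_comp t k (z - h)) \<partial>lborel)"
    unfolding heat_comp_def by (simp add: algebra_simps flip: integral_mult_right_zero)
  ultimately show ?thesis by linarith
qed

lemma heat_comp_bounds:
  assumes "t \<ge> 25" "y \<ge> 0"
  shows "0 \<le> heat_comp t k y" "heat_comp t k y \<le> exp (5 / 2 * decay_total) * ((y + 5) * decay k)"
proof -
  have tk: "spread t k \<ge> real k + 3" using spread_ge[of t k] assms by simp
  show "0 \<le> heat_comp t k y" unfolding heat_comp_def using tk assms by (intro mult_nonneg_nonneg heat_nonneg) auto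
  have "heat (spread t k) (y + 5) \<le> (y + 5) / (spread t k * sqrt (spread t k))"
    using tk assms by (intro heat_le) auto
  also have "\<dots> \<le> (y + 5) / ((real k + 3) * sqrt (real k + 3))"
    using tk assms by (intro divide_left_mono mult_mono mult_pos_pos) auto
  finally show "heat_comp t k y \<le> exp (5 / 2 * decay_total) * ((y + 5) * decay k)"
    unfolding heat_comp_def using decay_sum_le(2)[of k] tk assms
    by (intro mult_mono) (auto simp: decay_def intro!: heat_nonneg)
qed

text \<open>A multiple of the profile with initial variance \<open>36\<close> that absorbs the bound \<open>u \<le> 1\<close> below the barrier.\<close>

definition source_const :: real where "source_const = 12 * exp decay_total * sqrt (12 * exp decay_total)"

text \<open>\<open>36 + k \<le> 12 * (k + 3)\<close> compares the inflated variance with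
  \<open>k + 3\<close> uniformly in \<open>k\<close>, so the same multiple of the profile serves at
  every step.\<close>

lemma source_const: "decay k \<le> source_const * (1 / (spread 36 k * sqrt (spread 36 k)))"
proof -
  have tk: "spread 36 k > 0" using spread_ge[of 36 k] by simp
  have "spread 36 k \<le> exp (decay_sum k) * (36 + real k)" using spread_le[of 36 k] by simp
  also have "\<dots> \<le> exp decay_total * (12 * (real k + 3))"
    using decay_sum_le(2)[of k] by (intro mult_mono) auto
  finally have le: "spread 36 k \<le> 12 * exp decay_total * (real k + 3)" by (simp only: mult_ac)
  have "spread 36 k * sqrt (spread 36 k) \<le> (12 * exp decay_total * (real k + 3)) * sqrt (12 * exp decay_total * (real k + 3))"
    using tk le by (intro mult_mono) auto
  also have "\<dots> = source_const / decay k"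
    unfolding source_const_def decay_def real_sqrt_mult by simp
  finally show ?thesis using tk decay_pos[of k] by (simp add: field_simps)
qed

section \<open>Mixtures of heat profiles as supersolutions\<close>

definition mix_time :: "nat \<Rightarrow> real" where "mix_time i = (real i + 6)\<^sup>2"

lemma mix_time_ge: "mix_time i \<ge> 25"
  unfolding mix_time_def by (rule order_trans[OF _ power_mono[of 6]]) auto

definition heat_mix :: "(nat \<Rightarrow> real) \<Rightarrow> nat \<Rightarrow> real \<Rightarrow> nat \<Rightarrow> real \<Rightarrow> real" where
  "heat_mix a N \<epsilon> k y = (\<Sum>i<N. a i * heat_comp (mix_time i) k y) + \<epsilon>"

text \<open>Component \<open>0\<close> alone pays at every step for the region below the barrier;
  the other components and \<open>\<epsilon>\<close> serve to dominate the initial data.\<close>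

lemma branch_upper:
  assumes u: "tail_fun u" and a: "\<And>i. a i \<ge> 0" "a 0 \<ge> source_const" and N: "N > 0" and \<epsilon>: "\<epsilon> \<ge> 0"
    and init: "\<And>y. y \<ge> 0 \<Longrightarrow> u (X - barrier 0 + y) \<le> exp (- crit * (y - barrier 0)) * heat_mix a N \<epsilon> 0 y"
    and y: "y \<ge> 0"
  shows "(branch 1 ^^ k) u (X + crit * real k - barrier k + y) \<le> exp (- crit * (y - barrier k)) * heat_mix a N \<epsilon> k y"
  using y
proof (induction k arbitrary: y)
  case 0
  then show ?case using init by simp
next
  case (Suc k)
  define d where "d = barrier (Suc k) - barrier k"
  \<comment> \<open>Relative to the line of slope \<open>crit\<close> the barrier drops by
    \<open>d\<close>, so distance \<open>y\<close> from the new barrier is distance \<open>z\<close>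
    from the old one. Position and exponential weight then match those of
    \<open>branch_upper_step\<close> with \<open>l = barrier k\<close>.\<close>
  define z where "z = y - d"
  have z: "z \<ge> -1/2" using Suc.prems barrier_step(2)[of k] by (simp add: z_def d_def)
  have ic: "integrable lborel (\<lambda>h. std_normal_density h * (a i * heat_comp (mix_time i) k (z - h)))" for i
    using integrable_mult_right[OF heat_comp_integrable[OF mix_time_ge, of i k z], of "a i"] by (simp add: mult_ac)
  have ic': "integrable lborel (\<lambda>h. std_normal_density h * (indicator {z<..} h * (a i * heat_comp (mix_time i) k (z - h))))" for i
    by (rule integrable_gauss_ind[OF ic])
  have i1: "integrable lborel (\<lambda>h. std_normal_density h * (indicator {z<..} h * 1))"
    by (rule integrable_gauss_ind) simp
  let ?G = "\<integral>h. std_normal_density h * indicator {z<..} h \<partial>lborel"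
  let ?J = "\<lambda>i. \<integral>h. std_normal_density h * (indicator {z<..} h * (a i * heat_comp (mix_time i) k (z - h))) \<partial>lborel"
  have G: "?G \<ge> 0" by (intro integral_nonneg_AE) auto
  have J: "?J i = a i * (\<integral>h. std_normal_density h * (indicator {z<..} h * heat_comp (mix_time i) k (z - h)) \<partial>lborel)" for i
    by (simp add: algebra_simps flip: integral_mult_right_zero)
  have J0: "decay k * ?G \<le> ?J 0"
  proof -
    have t0: "mix_time 0 = 36" by (simp add: mix_time_def)
    have "decay k * ?G \<le> source_const * (1 / (spread 36 k * sqrt (spread 36 k))) * ?G"
      by (intro mult_right_mono source_const G)
    also have "\<dots> \<le> a 0 * (1 / (spread 36 k * sqrt (spread 36 k)) * ?G)"
      unfolding mult.assoc using spread_ge[of 36 k] G a by (intro mult_right_mono) auto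
    also have "\<dots> \<le> ?J 0"
      unfolding J unfolding t0 using heat_comp_tail[of 36 z k] z a(1)[of 0] by (intro mult_left_mono) auto
    finally show ?thesis .
  qed
  have Jnn: "?J i \<ge> 0" for i
  proof -
    have "0 \<le> 1 / (spread (mix_time i) k * sqrt (spread (mix_time i) k)) * ?G"
      using G spread_ge[of "mix_time i" k] mix_time_ge[of i] by (intro mult_nonneg_nonneg divide_nonneg_nonneg) auto
    also note heat_comp_tail[OF mix_time_ge z]
    finally show ?thesis unfolding J using a by auto
  qed
  have "branch 1 ((branch 1 ^^ k) u) (X + crit * real k - barrier k + crit + z)
      \<le> exp (- crit * (z - barrier k)) * gauss_avg (heat_mix a N \<epsilon> k) z"
  proof (rule branch_upper_step)
    show "tail_fun ((branch 1 ^^ k) u)" by (rule tail_fun_funpow[OF u])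
    show "(branch 1 ^^ k) u (X + crit * real k - barrier k + y)
         \<le> exp (- crit * (y - barrier k)) * heat_mix a N \<epsilon> k y" if "y \<ge> 0" for y
      by (rule Suc.IH[OF that])
    show "integrable lborel (\<lambda>h. std_normal_density h * heat_mix a N \<epsilon> k (z - h))"
      unfolding heat_mix_def distrib_left sum_distrib_left using ic by auto
    have "exp (- crit * barrier k) * ?G = decay k * ?G"
      using exp_barrier[of k] by (simp add: exp_minus)
    also have "\<dots> \<le> ?J 0" by (rule J0)
    also have "\<dots> \<le> (\<Sum>i<N. ?J i)" using N Jnn by (intro member_le_sum) auto
    also have "\<dots> \<le> (\<Sum>i<N. ?J i) + \<epsilon> * ?G" using G \<epsilon> by simp
    also have "\<dots> = (\<integral>h. (\<Sum>i<N. std_normal_density h * (indicator {z<..} h * (a i * heat_comp (mix_time i) k (z - h))))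
        + \<epsilon> * (std_normal_density h * (indicator {z<..} h * 1)) \<partial>lborel)"
      using ic' i1 by simp
    also have "\<dots> = (\<integral>h. std_normal_density h * (indicator {z<..} h * heat_mix a N \<epsilon> k (z - h)) \<partial>lborel)"
      by (simp add: heat_mix_def sum_distrib_left algebra_simps)
    finally show "exp (- crit * barrier k) * ?G \<le> (\<integral>h. std_normal_density h * (indicator {z<..} h * heat_mix a N \<epsilon> k (z - h)) \<partial>lborel)" .
  qed
  also have "gauss_avg (heat_mix a N \<epsilon> k) z \<le> heat_mix a N \<epsilon> (Suc k) y"
  proof -
    have "gauss_avg (heat_mix a N \<epsilon> k) z = (\<integral>h. (\<Sum>i<N. std_normal_density h * (a i * heat_comp (mix_time i) k (z - h))) + std_normal_density h * \<epsilon> \<partial>lborel)"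
      unfolding gauss_avg_def heat_mix_def distrib_left sum_distrib_left ..
    also have "\<dots> = (\<Sum>i<N. \<integral>h. std_normal_density h * (a i * heat_comp (mix_time i) k (z - h)) \<partial>lborel) + \<epsilon>"
      using ic by simp
    also have "\<dots> = (\<Sum>i<N. a i * gauss_avg (heat_comp (mix_time i) k) z) + \<epsilon>"
      unfolding gauss_avg_def by (simp add: algebra_simps flip: integral_mult_right_zero)
    also have "\<dots> \<le> heat_mix a N \<epsilon> (Suc k) y"
      unfolding heat_mix_def using heat_comp_step[OF mix_time_ge z, of _ k] a
      by (intro add_right_mono sum_mono mult_left_mono) (auto simp: z_def d_def)
    finally show ?thesis .
  qed
  finally show ?case by (simp add: z_def d_def algebra_simps)
qed

text \<open>The weight contributes \<open>1 / decay k\<close>, which cancels the decay of the heat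
  part and leaves a bound uniform in \<open>k\<close>. The constant \<open>\<epsilon>\<close> does
  not decay and keeps this factor, so it must be taken small depending on \<open>k\<close>.\<close>

lemma branch_upper_linear:
  assumes u: "tail_fun u" and a: "\<And>i. a i \<ge> 0" "a 0 \<ge> source_const" and N: "N > 0" and \<epsilon>: "\<epsilon> \<ge> 0"
    and init: "\<And>y. y \<ge> 0 \<Longrightarrow> u (X - barrier 0 + y) \<le> exp (- crit * (y - barrier 0)) * heat_mix a N \<epsilon> 0 y"
    and y: "y \<ge> 0"
  shows "(branch 1 ^^ k) u (X + crit * real k - barrier k + y)
    \<le> exp (- crit * y) * (exp (5 / 2 * decay_total) * (\<Sum>i<N. a i) * (y + 5) + \<epsilon> / decay k)"
proof -
  have "heat_mix a N \<epsilon> k y \<le> (\<Sum>i<N. a i * (exp (5 / 2 * decay_total) * ((y + 5) * decay k))) + \<epsilon>"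
    unfolding heat_mix_def using heat_comp_bounds[OF mix_time_ge y] a by (intro add_right_mono sum_mono mult_left_mono) auto
  also have "\<dots> = (exp (5 / 2 * decay_total) * (\<Sum>i<N. a i) * (y + 5) + \<epsilon> / decay k) * decay k"
    unfolding sum_distrib_right[symmetric] using decay_pos[of k] by (simp add: field_simps)
  finally have "exp (- crit * (y - barrier k)) * heat_mix a N \<epsilon> k y
     \<le> exp (- crit * (y - barrier k)) * ((exp (5 / 2 * decay_total) * (\<Sum>i<N. a i) * (y + 5) + \<epsilon> / decay k) * decay k)"
    by (rule mult_left_mono) simp
  also have "\<dots> = exp (- crit * y) * (exp (5 / 2 * decay_total) * (\<Sum>i<N. a i) * (y + 5) + \<epsilon> / decay k)"
  proof -
    have "- crit * (y - barrier k) = - crit * y + crit * barrier k" by (simp add: algebra_simps)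
    then have "exp (- crit * (y - barrier k)) = exp (- crit * y) / decay k"
      by (simp only: exp_add exp_barrier) simp
    then show ?thesis using decay_pos[of k] by simp
  qed
  finally show ?thesis using branch_upper[OF assms, of k] by (rule order_trans[rotated])
qed

text \<open>Exponential initial data are dominated by Gaussian ones of increasing variance; the truncation error
  is a constant, which also solves the heat equation.\<close>

definition mix_weight :: "real \<Rightarrow> nat \<Rightarrow> real" where "mix_weight \<kappa> i = exp (- \<kappa> * real i) * (mix_time i * sqrt (mix_time i))"

lemma mix_weight_nonneg: "mix_weight \<kappa> i \<ge> 0"
  unfolding mix_weight_def using mix_time_ge[of i] by auto

lemma summable_mix_weight:
  assumes "\<kappa> > 0"
  shows "summable (mix_weight \<kappa>)"
proof (rule summable_comparison_test_bigo)
  show "summable (\<lambda>n. norm (real n powr (-2)))" by (simp add: summable_real_powr_iff)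
  have "mix_weight \<kappa> = (\<lambda>i. exp (- \<kappa> * real i) * (real i + 6) ^ 3)"
    by (auto simp: mix_weight_def mix_time_def power3_eq_cube power2_eq_square fun_eq_iff)
  then show "mix_weight \<kappa> \<in> O(\<lambda>n. real n powr (-2))" using assms by simp real_asymp
qed

text \<open>On \<open>[i, i + 1]\<close> component \<open>i\<close> alone suffices; from
  \<open>N\<close> on the constant does.\<close>

lemma exp_le_heat_mix:
  assumes k: "\<kappa> > 0" and y: "y \<ge> 0"
  shows "exp (- \<kappa> * y) \<le> (\<Sum>i<N. mix_weight \<kappa> i * heat (mix_time i) (y + 5)) + exp (- \<kappa> * real N)"
proof -
  have nn: "0 \<le> mix_weight \<kappa> i * heat (mix_time i) (y + 5)" for i
    using mix_weight_nonneg[of \<kappa> i] mix_time_ge[of i] y by (intro mult_nonneg_nonneg heat_nonneg) auto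
  show ?thesis
  proof (cases "y < real N")
    case True
    define i where "i = nat \<lfloor>y\<rfloor>"
    have i: "real i \<le> y" "y \<le> real i + 1" using y unfolding i_def by linarith+
    then have iN: "i < N" using True by linarith
    \<comment> \<open>The reason for the choice of \<open>mix_time\<close>: its square root
      \<open>i + 6\<close> dominates \<open>y + 5\<close>, so the exponent is at least
      \<open>-1/2\<close>.\<close>
    have "(y + 5)\<^sup>2 \<le> mix_time i" unfolding mix_time_def using i y by (intro power_mono) auto
    then have "(y + 5)\<^sup>2 / (2 * mix_time i) \<le> 1 / 2" using mix_time_ge[of i] by (simp add: field_simps)
    then have "exp (- (y + 5)\<^sup>2 / (2 * mix_time i)) \<ge> 1 / 2"
      using exp_ge_add_one_self[of "- (y + 5)\<^sup>2 / (2 * mix_time i)"] by simp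
    then have "(y + 5) * exp (- (y + 5)\<^sup>2 / (2 * mix_time i)) \<ge> 2 * (1 / 2)"
      using y by (intro mult_mono) auto
    then have h: "1 \<le> (mix_time i * sqrt (mix_time i)) * heat (mix_time i) (y + 5)"
      unfolding heat_def using mix_time_ge[of i] by simp
    have "exp (- \<kappa> * y) \<le> exp (- \<kappa> * real i) * 1" using i k by simp
    also have "\<dots> \<le> exp (- \<kappa> * real i) * ((mix_time i * sqrt (mix_time i)) * heat (mix_time i) (y + 5))"
      by (intro mult_left_mono h) auto
    also have "\<dots> = mix_weight \<kappa> i * heat (mix_time i) (y + 5)" by (simp add: mix_weight_def)
    also have "\<dots> \<le> (\<Sum>i<N. mix_weight \<kappa> i * heat (mix_time i) (y + 5))"
      using iN nn by (intro member_le_sum) auto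
    finally show ?thesis by (smt (verit) exp_gt_zero)
  next
    case False
    then have "exp (- \<kappa> * y) \<le> exp (- \<kappa> * real N)" using k by simp
    moreover have "0 \<le> (\<Sum>i<N. mix_weight \<kappa> i * heat (mix_time i) (y + 5))" by (intro sum_nonneg nn)
    ultimately show ?thesis by linarith
  qed
qed

section \<open>Upper bounds for one and for two speeds\<close>

definition neg_ind :: "real \<Rightarrow> real" where "neg_ind x = (if x < 0 then 1 else 0)"

lemma tail_fun_neg_ind: "tail_fun neg_ind"
proof -
  have "neg_ind \<in> borel_measurable borel" unfolding neg_ind_def by measurable
  then show ?thesis by (auto simp: tail_fun_def neg_ind_def)
qed

abbreviation hom_tail :: "nat \<Rightarrow> real \<Rightarrow> real" where "hom_tail m \<equiv> (branch 1 ^^ m) neg_ind"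

lemma branch_funpow_neg_ind:
  assumes "\<sigma> > 0"
  shows "(branch \<sigma> ^^ m) neg_ind (\<sigma> * x) = hom_tail m x"
proof -
  have "(\<lambda>x. neg_ind (\<sigma> * x)) = neg_ind"
    using assms by (auto simp: neg_ind_def fun_eq_iff mult_less_0_iff)
  then show ?thesis unfolding branch_funpow_scale by simp
qed

text \<open>The offset \<open>barrier 0\<close> gives \<open>front 0 = 0\<close>, the point where
  \<open>neg_ind\<close> jumps.\<close>

definition front :: "nat \<Rightarrow> real" where "front m = barrier 0 + crit * real m - barrier m"

lemma sum_mix_weight_le: "\<kappa> > 0 \<Longrightarrow> (\<Sum>i<N. mix_weight \<kappa> i) \<le> suminf (mix_weight \<kappa>)"
  by (intro sum_le_suminf summable_mix_weight) (auto simp: mix_weight_nonneg)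

lemma heat_comp_0: "heat_comp t 0 y = heat t (y + 5)"
  by (simp add: heat_comp_def decay_sum_def)

text \<open>\<open>neg_ind\<close> vanishes above the initial barrier, so one component and
  \<open>\<epsilon> = 0\<close> suffice, and the bound is uniform in \<open>m\<close>.\<close>

lemma hom_tail_upper:
  obtains C where "C \<ge> 0" "\<And>m y. y \<ge> 0 \<Longrightarrow> hom_tail m (front m + y) \<le> C * (y + 5) * exp (- crit * y)"
proof
  have sc: "source_const \<ge> 0" by (simp add: source_const_def)
  show "exp (5 / 2 * decay_total) * source_const \<ge> 0" using sc by simp
  fix m and y :: real
  assume y: "y \<ge> 0"
  have "hom_tail m (barrier 0 + crit * real m - barrier m + y)
    \<le> exp (- crit * y) * (exp (5 / 2 * decay_total) * (\<Sum>i<(1::nat). source_const) * (y + 5) + 0 / decay m)"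
  proof (rule branch_upper_linear)
    fix y :: real assume "y \<ge> 0"
    then show "neg_ind (barrier 0 - barrier 0 + y) \<le> exp (- crit * (y - barrier 0)) * heat_mix (\<lambda>_. source_const) 1 0 0 y"
      using sc heat_comp_bounds(1)[OF mix_time_ge[of 0], of y 0] by (simp add: heat_mix_def neg_ind_def)
  qed (use sc y tail_fun_neg_ind in auto)
  then show "hom_tail m (front m + y) \<le> exp (5 / 2 * decay_total) * source_const * (y + 5) * exp (- crit * y)"
    by (simp add: front_def mult_ac)
qed

lemma two_speed_upper:
  fixes \<sigma>\<^sub>1 \<sigma>\<^sub>2 :: real
  assumes s: "0 < \<sigma>\<^sub>2" "\<sigma>\<^sub>2 < \<sigma>\<^sub>1"
  obtains K :: real where "\<And>(m\<^sub>1::nat) (m\<^sub>2::nat) (y::real). y \<ge> 0 \<Longrightarrow>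
    (branch \<sigma>\<^sub>1 ^^ m\<^sub>1) ((branch \<sigma>\<^sub>2 ^^ m\<^sub>2) neg_ind) (\<sigma>\<^sub>2 * front m\<^sub>2 + \<sigma>\<^sub>1 * (front m\<^sub>1 + y)) \<le> K * (y + 5) * exp (- crit * y)"
proof -
  obtain C where C: "C \<ge> 0" "\<And>m y. y \<ge> 0 \<Longrightarrow> hom_tail m (front m + y) \<le> C * (y + 5) * exp (- crit * y)"
    using hom_tail_upper by blast
  define r where "r = \<sigma>\<^sub>1 / \<sigma>\<^sub>2"
  have r: "r > 1" "\<sigma>\<^sub>1 = \<sigma>\<^sub>2 * r" using s by (auto simp: r_def)
  \<comment> \<open>Half of the surplus rate \<open>crit * (r - 1)\<close>. The other half absorbs
    the linear factor \<open>r * y + 5\<close> of the tail of the second half.\<close>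
  define \<kappa> where "\<kappa> = crit * (r - 1) / 2"
  have k: "\<kappa> > 0" using r crit_pos by (simp add: \<kappa>_def)
  define D where "D = C * (r / \<kappa> + 5) * exp (- crit * barrier 0)"
  have D: "D \<ge> 0" using C r k by (simp add: D_def)
  define a where "a i = D * mix_weight \<kappa> i + (if i = 0 then source_const else 0)" for i :: nat
  have sc: "source_const \<ge> 0" by (simp add: source_const_def)
  define S where "S = D * suminf (mix_weight \<kappa>) + source_const"
  have suma: "(\<Sum>i<N. a i) \<le> S" for N
  proof -
    have "(\<Sum>i<N. a i) = D * (\<Sum>i<N. mix_weight \<kappa> i) + (\<Sum>i<N. if i = 0 then source_const else 0)"
      by (simp add: a_def sum.distrib sum_distrib_left)
    also have "\<dots> \<le> S" unfolding S_def
      using sum_mix_weight_le[OF k, of N] D sc by (intro add_mono mult_left_mono) auto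
    finally show ?thesis .
  qed
  show thesis
  proof (rule that)
    fix m\<^sub>1 m\<^sub>2 :: nat and y :: real
    assume y: "y \<ge> 0"
    define f where "f x = (branch \<sigma>\<^sub>2 ^^ m\<^sub>2) neg_ind (\<sigma>\<^sub>1 * x)" for x
    have f: "tail_fun f" unfolding f_def
      using tail_fun_scale[of "(branch \<sigma>\<^sub>2 ^^ m\<^sub>2) neg_ind" \<sigma>\<^sub>1 0] tail_fun_funpow[OF tail_fun_neg_ind] by simp
    have fr: "f x = hom_tail m\<^sub>2 (r * x)" for x
      unfolding f_def r(2) mult.assoc by (rule branch_funpow_neg_ind[OF s(1)])
    \<comment> \<open>The truncation level \<open>N\<close> may depend on \<open>m\<^sub>1\<close>:
      it only has to beat \<open>1 / decay m\<^sub>1\<close>, while the coefficients sum to at most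
      \<open>S\<close> whatever \<open>N\<close> is.\<close>
    have "(\<lambda>n. exp (- \<kappa> * real n)) \<longlonglongrightarrow> 0"
      using k by real_asymp
    then have "(\<lambda>n. D * exp (- \<kappa> * real n) / decay m\<^sub>1) \<longlonglongrightarrow> D * 0 / decay m\<^sub>1"
      using decay_pos[of m\<^sub>1] by (intro tendsto_intros) auto
    then have "(\<lambda>n. D * exp (- \<kappa> * real n) / decay m\<^sub>1) \<longlonglongrightarrow> 0"
      by simp
    then have "eventually (\<lambda>n. D * exp (- \<kappa> * real n) / decay m\<^sub>1 < 1) sequentially"
      by (rule order_tendstoD) simp
    moreover have "eventually (\<lambda>n::nat. n > 0) sequentially" by (rule eventually_gt_at_top)
    ultimately have "eventually (\<lambda>n. D * exp (- \<kappa> * real n) / decay m\<^sub>1 < 1 \<and> n > 0) sequentially"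
      by (rule eventually_conj)
    then obtain N where N: "D * exp (- \<kappa> * real N) / decay m\<^sub>1 < 1" "N > 0"
      using eventually_happens'[OF sequentially_bot] by blast
    define \<epsilon> where "\<epsilon> = D * exp (- \<kappa> * real N)"
    \<comment> \<open>In units of \<open>\<sigma>\<^sub>1\<close> the front of the second half lies
      at \<open>front m\<^sub>2 / r\<close>; the initial barrier is placed exactly there.\<close>
    define X where "X = front m\<^sub>2 / r + barrier 0"
    have "(branch 1 ^^ m\<^sub>1) f (X + crit * real m\<^sub>1 - barrier m\<^sub>1 + y)
      \<le> exp (- crit * y) * (exp (5 / 2 * decay_total) * (\<Sum>i<N. a i) * (y + 5) + \<epsilon> / decay m\<^sub>1)"
    proof (rule branch_upper_linear[OF f _ _ N(2) _ _ y])
      show "0 \<le> a i" for i using D mix_weight_nonneg[of \<kappa> i] sc by (simp add: a_def)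
      show "source_const \<le> a 0" using D mix_weight_nonneg[of \<kappa> 0] by (simp add: a_def)
      show "0 \<le> \<epsilon>" using D by (simp add: \<epsilon>_def)
      fix y :: real assume y: "y \<ge> 0"
      have "f (X - barrier 0 + y) = hom_tail m\<^sub>2 (front m\<^sub>2 + r * y)"
        unfolding fr X_def using r by (simp add: algebra_simps)
      also have "\<dots> \<le> C * (r * y + 5) * exp (- crit * (r * y))" using r y by (intro C) auto
      also have "\<dots> \<le> C * ((r / \<kappa> + 5) * exp (\<kappa> * y)) * exp (- crit * (r * y))"
      proof (intro mult_right_mono mult_left_mono C)
        have "r * y + 5 \<le> (r / \<kappa> + 5) * (1 + \<kappa> * y)" using k r y by (simp add: field_simps)
        also have "\<dots> \<le> (r / \<kappa> + 5) * exp (\<kappa> * y)"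
          using k r by (intro mult_left_mono exp_ge_add_one_self) auto
        finally show "r * y + 5 \<le> (r / \<kappa> + 5) * exp (\<kappa> * y)" .
      qed simp
      also have "\<dots> = exp (- crit * (y - barrier 0)) * (D * exp (- \<kappa> * y))"
      proof -
        have "\<kappa> * y + - crit * (r * y) = - crit * (y - barrier 0) + (- crit * barrier 0 + - \<kappa> * y)"
          by (simp add: \<kappa>_def field_simps)
        then have e: "exp (\<kappa> * y) * exp (- crit * (r * y)) = exp (- crit * (y - barrier 0)) * (exp (- crit * barrier 0) * exp (- \<kappa> * y))"
          by (simp only: exp_add[symmetric])
        have "C * ((r / \<kappa> + 5) * exp (\<kappa> * y)) * exp (- crit * (r * y))
          = C * (r / \<kappa> + 5) * (exp (\<kappa> * y) * exp (- crit * (r * y)))" by (simp only: mult_ac)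
        then show ?thesis unfolding e D_def by (simp only: mult_ac)
      qed
      also have "\<dots> \<le> exp (- crit * (y - barrier 0)) * heat_mix a N \<epsilon> 0 y"
      proof (intro mult_left_mono)
        have "D * exp (- \<kappa> * y) \<le> D * ((\<Sum>i<N. mix_weight \<kappa> i * heat (mix_time i) (y + 5)) + exp (- \<kappa> * real N))"
          by (intro mult_left_mono exp_le_heat_mix k y D)
        also have "\<dots> = (\<Sum>i<N. D * mix_weight \<kappa> i * heat_comp (mix_time i) 0 y) + \<epsilon>"
          unfolding heat_comp_0 \<epsilon>_def by (simp add: distrib_left sum_distrib_left mult_ac)
        also have "\<dots> \<le> heat_mix a N \<epsilon> 0 y" unfolding heat_mix_def a_def
          using sc heat_comp_bounds(1)[OF mix_time_ge y] by (intro add_right_mono sum_mono mult_right_mono) auto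
        finally show "D * exp (- \<kappa> * y) \<le> heat_mix a N \<epsilon> 0 y" .
      qed simp
      finally show "f (X - barrier 0 + y) \<le> exp (- crit * (y - barrier 0)) * heat_mix a N \<epsilon> 0 y" .
    qed
    also have "\<dots> \<le> exp (- crit * y) * (exp (5 / 2 * decay_total) * S * (y + 5) + 1 * (y + 5))"
      using suma[of N] N(1) y unfolding \<epsilon>_def
      by (intro mult_left_mono add_mono mult_right_mono) auto
    also have "\<dots> = (exp (5 / 2 * decay_total) * S + 1) * (y + 5) * exp (- crit * y)"
      by (simp add: algebra_simps)
    also have "X + crit * real m\<^sub>1 - barrier m\<^sub>1 + y = front m\<^sub>2 / r + (front m\<^sub>1 + y)"
      by (simp add: X_def front_def)
    also have "(branch 1 ^^ m\<^sub>1) f (front m\<^sub>2 / r + (front m\<^sub>1 + y))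
      = (branch \<sigma>\<^sub>1 ^^ m\<^sub>1) ((branch \<sigma>\<^sub>2 ^^ m\<^sub>2) neg_ind) (\<sigma>\<^sub>1 * (front m\<^sub>2 / r + (front m\<^sub>1 + y)))"
      unfolding branch_funpow_scale f_def ..
    also have "\<sigma>\<^sub>1 * (front m\<^sub>2 / r + (front m\<^sub>1 + y)) = \<sigma>\<^sub>2 * front m\<^sub>2 + \<sigma>\<^sub>1 * (front m\<^sub>1 + y)"
      using r by (simp add: distrib_left)
    finally show "(branch \<sigma>\<^sub>1 ^^ m\<^sub>1) ((branch \<sigma>\<^sub>2 ^^ m\<^sub>2) neg_ind) (\<sigma>\<^sub>2 * front m\<^sub>2 + \<sigma>\<^sub>1 * (front m\<^sub>1 + y))
      \<le> (exp (5 / 2 * decay_total) * S + 1) * (y + 5) * exp (- crit * y)" .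
  qed
qed

subsection \<open>Subsolutions\<close>

text \<open>A second moment argument in the form of a subsolution: \<open>A\<close> is a first moment, and \<open>B\<close> collects the
  quadratic losses.\<close>

lemma branch_lower_step:
  assumes u: "tail_fun u"
    and bound: "\<And>y. y \<ge> 0 \<Longrightarrow> exp (- s * y) * (A y - B y) \<le> u (X + y)"
    and A: "integrable lborel (\<lambda>h. std_normal_density h * A (z - h))" "\<And>y. y \<ge> 0 \<Longrightarrow> A y \<ge> 0"
    and B: "integrable lborel (\<lambda>h. std_normal_density h * B (z - h))" "\<And>y. y \<ge> 0 \<Longrightarrow> B y \<ge> 0"
  defines "\<rho> \<equiv> 2 * exp (- s\<^sup>2 / 2)"
    and "P \<equiv> \<integral>h. std_normal_density h * (indicator {..z} h * A (z - h)) \<partial>lborel"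
    and "R \<equiv> \<integral>h. std_normal_density h * (indicator {..z} h * B (z - h)) \<partial>lborel"
  shows "exp (- s * z) * (\<rho> * P - (\<rho> * R + \<rho>\<^sup>2 / 4 * exp (- s * z) * P\<^sup>2)) \<le> branch 1 u (X + s + z)"
proof -
  define p where "p = gauss_avg u (X + s + z)"
  have p: "0 \<le> p" "p \<le> 1"
    using tail_fun_avg[OF u, of "X + s + z" 1] by (simp_all add: p_def gauss_avg_def)
  have iA: "integrable lborel (\<lambda>h. std_normal_density h * (indicator {..z} h * A (z - h)))"
    and iB: "integrable lborel (\<lambda>h. std_normal_density h * (indicator {..z} h * B (z - h)))"
    using integrable_gauss_ind A B by auto
  have P: "P \<ge> 0" and R: "R \<ge> 0" unfolding P_def R_def using A B
    by (auto intro!: integral_nonneg_AE AE_I2 split: split_indicator)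
  have iu: "integrable lborel (\<lambda>h. std_normal_density h * (exp (- s * h) * u (X + z - h)))"
  proof -
    have "integrable lborel (\<lambda>h. std_normal_density (s + 1 * h) * u (X + s + z - (s + 1 * h)))"
      using lborel_integrable_real_affine[of "\<lambda>y. std_normal_density y * u (X + s + z - y)" 1 s]
        tail_fun_integrable[OF u, of "X + s + z" 1] by simp
    then have "integrable lborel (\<lambda>h. exp (s\<^sup>2 / 2) * (std_normal_density (s + h) * u (X + z - h)))"
      by (intro integrable_mult_right) (simp add: algebra_simps)
    also have "(\<lambda>h. exp (s\<^sup>2 / 2) * (std_normal_density (s + h) * u (X + z - h)))
      = (\<lambda>h. std_normal_density h * (exp (- s * h) * u (X + z - h)))"
    proof
      fix h
      have "exp (s\<^sup>2 / 2) * std_normal_density (s + h) = std_normal_density h * exp (- s * h)"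
        unfolding std_normal_density_def
        by (simp add: exp_add[symmetric]) (simp add: field_simps power2_eq_square)
      then show "exp (s\<^sup>2 / 2) * (std_normal_density (s + h) * u (X + z - h))
        = std_normal_density h * (exp (- s * h) * u (X + z - h))"
        by (simp only: mult.assoc[symmetric])
    qed
    finally show ?thesis .
  qed
  define a where "a = exp (- s * z) * (\<rho> / 2) * P"
  define b where "b = exp (- s * z) * (\<rho> / 2) * R"
  have ab: "a \<ge> 0" "b \<ge> 0" using P R by (auto simp: a_def b_def \<rho>_def)
  have "exp (- s * z) * (P - R) = (\<integral>h. exp (- s * z) * (std_normal_density h * (indicator {..z} h * A (z - h))
      - std_normal_density h * (indicator {..z} h * B (z - h))) \<partial>lborel)"
    using iA iB by (simp add: P_def R_def)
  also have "\<dots> \<le> (\<integral>h. std_normal_density h * (exp (- s * h) * u (X + z - h)) \<partial>lborel)"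
  proof (intro integral_mono iu)
    show "exp (- s * z) * (std_normal_density h * (indicator {..z} h * A (z - h))
      - std_normal_density h * (indicator {..z} h * B (z - h)))
      \<le> std_normal_density h * (exp (- s * h) * u (X + z - h))" for h
    proof (cases "h \<le> z")
      case True
      have e: "exp (- s * z) = exp (- s * h) * exp (- s * (z - h))"
        by (simp add: exp_add[symmetric] algebra_simps)
      have "exp (- s * h) * (exp (- s * (z - h)) * (A (z - h) - B (z - h))) \<le> exp (- s * h) * u (X + (z - h))"
        using True by (intro mult_left_mono bound) auto
      then have "exp (- s * z) * (A (z - h) - B (z - h)) \<le> exp (- s * h) * u (X + z - h)"
        unfolding e by (simp add: mult.assoc algebra_simps)
      then have "std_normal_density h * (exp (- s * z) * (A (z - h) - B (z - h))) \<le> std_normal_density h * (exp (- s * h) * u (X + z - h))"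
        by (rule mult_left_mono) simp
      then show ?thesis using True by (simp add: algebra_simps)
    next
      \<comment> \<open>This region lies below the line, where only \<open>u \<ge> 0\<close> is
        used: the walk is killed there.\<close>
      case False
      then show ?thesis using tail_funD[OF u] by simp
    qed
  qed (use iA iB in auto)
  also have "\<dots> = p / exp (- s\<^sup>2 / 2)" unfolding p_def gauss_avg_tilt[of u _ s] by (simp add: algebra_simps)
  finally have "exp (- s * z) * (P - R) * exp (- s\<^sup>2 / 2) \<le> p"
    by (simp only: pos_le_divide_eq[OF exp_gt_zero])
  then have abp: "a - b \<le> p" by (simp add: a_def b_def \<rho>_def algebra_simps)
  \<comment> \<open>\<open>1 - (1 - p)\<^sup>2 = 2 * p - p\<^sup>2\<close> is increasing on the unit
    interval, so \<open>p\<close> may be lowered to \<open>a - b\<close> if this is nonnegative, and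
    \<open>(a - b)\<^sup>2 \<le> a\<^sup>2\<close>. Otherwise the left side is not positive.\<close>
  have "2 * (a - b) - a\<^sup>2 \<le> 1 - (1 - p)\<^sup>2"
  proof (cases "a - b \<ge> 0")
    case True
    have "(a - b)\<^sup>2 \<le> a\<^sup>2" using True ab by (intro power_mono) auto
    moreover have "1 - (1 - (a - b))\<^sup>2 \<le> 1 - (1 - p)\<^sup>2" by (intro one_minus_sq_mono abp p)
    ultimately show ?thesis by (simp add: power2_eq_square algebra_simps)
  next
    case False
    then have "2 * (a - b) - a\<^sup>2 \<le> 0" by (smt (verit) zero_le_power2)
    also have "0 \<le> 1 - (1 - p)\<^sup>2" using p by (simp add: power_le_one)
    finally show ?thesis .
  qed
  also have "2 * (a - b) - a\<^sup>2 = exp (- s * z) * (\<rho> * P - (\<rho> * R + \<rho>\<^sup>2 / 4 * exp (- s * z) * P\<^sup>2))"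
    by (simp add: a_def b_def power2_eq_square algebra_simps)
  finally show ?thesis by (simp add: branch_1 p_def)
qed

text \<open>Below the line the odd profile is negative, so killing there only increases the average:
  the profile is a subsolution of the killed walk.\<close>

lemma heat_restrict_ge:
  assumes t: "t > 0"
  shows "heat (t + 1) z \<le> (\<integral>h. std_normal_density h * (indicator {..z} h * heat t (z - h)) \<partial>lborel)"
proof -
  have "heat (t + 1) z = (\<integral>h. std_normal_density h * heat t (z - h) \<partial>lborel)"
    using gauss_avg_heat[OF t, of z] by (simp add: gauss_avg_def)
  also have "\<dots> \<le> (\<integral>h. std_normal_density h * (indicator {..z} h * heat t (z - h)) \<partial>lborel)"
  proof (intro integral_mono mult_left_mono integrable_gauss_ind integrable_gauss_heat t)
    fix h show "heat t (z - h) \<le> indicator {..z} h * heat t (z - h)"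
      using t by (auto simp: heat_def mult_le_0_iff divide_le_0_iff split: split_indicator)
  qed simp
  finally show ?thesis .
qed

text \<open>The Gaussian factor is dropped and \<open>- h \<le> 1 / 2 + h\<^sup>2 / 2\<close> is
  averaged with second moment one. The bound is used for the square of the first moment.\<close>

lemma heat_restrict_le:
  assumes t: "t > 0" and z: "z \<ge> 0"
  shows "(\<integral>h. std_normal_density h * (indicator {..z} h * heat t (z - h)) \<partial>lborel) \<le> (z + 1) / (t * sqrt t)"
proof -
  have i: "integrable lborel (\<lambda>h. (z + 1 / 2) * std_normal_density h + (1 / 2) * (std_normal_density h * h ^ 2))"
    by (intro Bochner_Integration.integrable_add integrable_mult_right integrable_std_normal_moment) auto
  have "(\<integral>h. std_normal_density h * (indicator {..z} h * heat t (z - h)) \<partial>lborel)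
    \<le> (\<integral>h. 1 / (t * sqrt t) * ((z + 1 / 2) * std_normal_density h + (1 / 2) * (std_normal_density h * h ^ 2)) \<partial>lborel)"
  proof (rule integral_mono)
    fix h
    have "indicator {..z} h * heat t (z - h) \<le> 1 / (t * sqrt t) * (z + 1 / 2 + 1 / 2 * h\<^sup>2)"
    proof (cases "h \<le> z")
      case True
      have "heat t (z - h) \<le> (z - h) / (t * sqrt t)" using t True by (intro heat_le) auto
      also have "\<dots> \<le> (z + 1 / 2 + 1 / 2 * h\<^sup>2) / (t * sqrt t)"
        using t sum_squares_ge_zero[of "h + 1" 0]
        by (intro divide_right_mono) (auto simp: power2_eq_square algebra_simps)
      finally show ?thesis using True by simp
    next
      case False
      then show ?thesis using t z by (auto intro!: divide_nonneg_nonneg add_nonneg_nonneg)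
    qed
    then have "std_normal_density h * (indicator {..z} h * heat t (z - h)) \<le> std_normal_density h * (1 / (t * sqrt t) * (z + 1 / 2 + 1 / 2 * h\<^sup>2))"
      by (rule mult_left_mono) simp
    then show "std_normal_density h * (indicator {..z} h * heat t (z - h))
      \<le> 1 / (t * sqrt t) * ((z + 1 / 2) * std_normal_density h + (1 / 2) * (std_normal_density h * h ^ 2))"
      by (simp add: algebra_simps add_divide_distrib)
  qed (use i t in \<open>auto intro!: integrable_gauss_ind\<close>)
  also have "\<dots> = 1 / (t * sqrt t) * ((z + 1 / 2) + 1 / 2)"
  proof -
    have "(\<integral>h. std_normal_density h * h ^ 2 \<partial>lborel) = 1"
      using integral_std_normal_moment_even[of 1] by simp
    then show ?thesis
      using integrable_std_normal_moment[of 2] by simp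
  qed
  finally show ?thesis by (simp add: add.commute)
qed

text \<open>The counterpart of \<open>heat_restrict_ge\<close>: once the zero is moved by five, the
  mass entering from below is nonnegative, and dropping it decreases the average. The shifted
  profile is a supersolution of the killed walk.\<close>

lemma heat_restrict_shift_le:
  assumes t: "t \<ge> 25" and z: "z \<ge> 0"
  shows "(\<integral>h. std_normal_density h * (indicator {..z} h * heat t (z - h + 5)) \<partial>lborel) \<le> heat (t + 1) (z + 5)"
proof -
  have i: "integrable lborel (\<lambda>h. std_normal_density h * heat t (z - h + 5))"
    using integrable_gauss_heat[of t "z + 5"] t by (simp add: algebra_simps)
  have "0 \<le> (\<integral>y. std_normal_density y * indicator {z<..} y \<partial>lborel)" by (intro integral_nonneg_AE) auto
  also have "\<dots> \<le> t * sqrt t * (\<integral>y. std_normal_density y * (indicator {z<..} y * heat t (z - y + 5)) \<partial>lborel)"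
    using gauss_heat_tail[OF t, of z] z by simp
  finally have nn: "0 \<le> t * sqrt t * (\<integral>y. std_normal_density y * (indicator {z<..} y * heat t (z - y + 5)) \<partial>lborel)" .
  have "0 \<le> (\<integral>y. std_normal_density y * (indicator {z<..} y * heat t (z - y + 5)) \<partial>lborel)"
  proof -
    have "0 < t * sqrt t" using t by simp
    then show ?thesis using nn by (simp only: zero_le_mult_iff) auto
  qed
  then have "(\<integral>h. std_normal_density h * (indicator {..z} h * heat t (z - h + 5)) \<partial>lborel)
    \<le> (\<integral>h. std_normal_density h * (indicator {..z} h * heat t (z - h + 5)) + std_normal_density h * (indicator {z<..} h * heat t (z - h + 5)) \<partial>lborel)"
    using integrable_gauss_ind[OF i] by simp
  also have "\<dots> = (\<integral>h. std_normal_density h * heat t (z - h + 5) \<partial>lborel)"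
    by (intro Bochner_Integration.integral_cong) (auto split: split_indicator)
  also have "\<dots> = heat (t + 1) (z + 5)"
    using gauss_avg_heat[of t "z + 5"] t by (simp add: gauss_avg_def algebra_simps)
  finally show ?thesis .
qed

section \<open>Supersolutions of the killed walk, for the second moment\<close>

definition killed_mix :: "nat \<Rightarrow> real \<Rightarrow> nat \<Rightarrow> real \<Rightarrow> real" where
  "killed_mix N \<epsilon> m y = (\<Sum>i<N. mix_weight (1/4) i * heat (mix_time i + real m) (y + 5)) + \<epsilon>"

lemma killed_mix_nonneg: "killed_mix N \<epsilon> m y \<ge> 0" if "\<epsilon> \<ge> 0" "y \<ge> 0"
proof -
  have "0 < mix_time i + real m" for i using mix_time_ge[of i] by linarith
  then show ?thesis unfolding killed_mix_def using that
    by (intro add_nonneg_nonneg sum_nonneg mult_nonneg_nonneg mix_weight_nonneg heat_nonneg) auto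
qed

lemma killed_mix_integrable: "integrable lborel (\<lambda>h. std_normal_density h * killed_mix N \<epsilon> m (z - h))"
proof -
  have "integrable lborel (\<lambda>h. std_normal_density h * (mix_weight (1/4) i * heat (mix_time i + real m) (z - h + 5)))" for i
  proof -
    have "mix_time i + real m > 0" using mix_time_ge[of i] by linarith
    from integrable_mult_right[OF integrable_gauss_heat[OF this, of "z + 5"], of "mix_weight (1/4) i"]
    show ?thesis by (simp add: algebra_simps)
  qed
  then show ?thesis unfolding killed_mix_def distrib_left sum_distrib_left by auto
qed

lemma killed_mix_step:
  assumes \<epsilon>: "\<epsilon> \<ge> 0" and z: "z \<ge> 0"
  shows "(\<integral>h. std_normal_density h * (indicator {..z} h * killed_mix N \<epsilon> m (z - h)) \<partial>lborel) \<le> killed_mix N \<epsilon> (Suc m) z"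
proof -
  let ?w = "mix_weight (1/4)"
  have t: "mix_time i + real m \<ge> 25" for i using mix_time_ge[of i] by linarith
  have i: "integrable lborel (\<lambda>h. std_normal_density h * (indicator {..z} h * heat (mix_time i + real m) (z - h + 5)))" for i
    using integrable_gauss_heat[of "mix_time i + real m" "z + 5"] t[of i]
    by (intro integrable_gauss_ind) (simp add: algebra_simps)
  have i1: "integrable lborel (\<lambda>h. std_normal_density h * (indicator {..z} h * 1))"
    by (rule integrable_gauss_ind) simp
  have "(\<integral>h. std_normal_density h * (indicator {..z} h * killed_mix N \<epsilon> m (z - h)) \<partial>lborel)
    = (\<integral>h. (\<Sum>i<N. ?w i * (std_normal_density h * (indicator {..z} h * heat (mix_time i + real m) (z - h + 5))))
        + \<epsilon> * (std_normal_density h * (indicator {..z} h * 1)) \<partial>lborel)"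
    unfolding killed_mix_def distrib_left sum_distrib_left by (simp only: mult_ac mult_1_right mult_1)
  also have "\<dots> = (\<Sum>i<N. ?w i * (\<integral>h. std_normal_density h * (indicator {..z} h * heat (mix_time i + real m) (z - h + 5)) \<partial>lborel))
        + \<epsilon> * (\<integral>h. std_normal_density h * (indicator {..z} h * 1) \<partial>lborel)"
    using i i1 by simp
  also have "\<dots> \<le> (\<Sum>i<N. ?w i * heat (mix_time i + real m + 1) (z + 5)) + \<epsilon> * 1"
  proof (intro add_mono sum_mono mult_left_mono heat_restrict_shift_le t z mix_weight_nonneg \<epsilon>)
    have "(\<integral>h. std_normal_density h * (indicator {..z} h * 1) \<partial>lborel) \<le> (\<integral>h. std_normal_density h \<partial>lborel)"
      using i1 by (intro integral_mono) (auto split: split_indicator)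
    then show "(\<integral>h. std_normal_density h * (indicator {..z} h * 1) \<partial>lborel) \<le> 1" by simp
  qed
  also have "\<dots> = killed_mix N \<epsilon> (Suc m) z" by (simp add: killed_mix_def add_ac)
  finally show ?thesis .
qed

text \<open>The left side is the spatial shape of a quadratic loss when it arises. Of the rate
  \<open>s \<ge> 1/2\<close>, a part \<open>1/4\<close> absorbs \<open>(z + 1)\<^sup>2\<close> and
  the remaining rate \<open>1/4\<close> is the one built into \<open>killed_mix\<close>.\<close>

lemma killed_mix_0_ge:
  assumes s: "s \<ge> 1/2" and z: "z \<ge> 0"
  shows "(z + 1)\<^sup>2 * exp (- s * z) \<le> 128 * killed_mix N (exp (- 1/4 * real N)) 0 z"
proof -
  have "(z + 1) \<le> 8 * (1 + z / 8)" using z by simp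
  also have "\<dots> \<le> 8 * exp (z / 8)" by (intro mult_left_mono exp_ge_add_one_self) auto
  finally have "(z + 1)\<^sup>2 \<le> (8 * exp (z / 8))\<^sup>2" using z by (intro power_mono) auto
  also have "\<dots> = 64 * exp (z / 4)" by (simp add: power_mult_distrib power2_eq_square exp_add[symmetric])
  finally have sq: "(z + 1)\<^sup>2 \<le> 64 * exp (z / 4)" .
  have "1 / 2 * z \<le> s * z" using s z by (intro mult_right_mono) auto
  with sq have "(z + 1)\<^sup>2 * exp (- s * z) \<le> 64 * exp (z / 4) * exp (- (1/2) * z)"
    by (intro mult_mono) auto
  also have "\<dots> = 64 * exp (- (1/4) * z)" by (simp add: exp_add[symmetric])
  also have "\<dots> \<le> 128 * exp (- (1/4) * z)" by simp
  also have "\<dots> \<le> 128 * killed_mix N (exp (- 1/4 * real N)) 0 z"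
    using exp_le_heat_mix[of "1/4" z N] z by (simp add: killed_mix_def)
  finally show ?thesis .
qed

lemma killed_mix_le:
  assumes y: "y \<ge> 0"
  shows "killed_mix N \<epsilon> m y \<le> suminf (mix_weight (1/4)) * ((y + 5) / ((real m + 1) * sqrt (real m + 1))) + \<epsilon>"
proof -
  have "heat (mix_time i + real m) (y + 5) \<le> (y + 5) / ((real m + 1) * sqrt (real m + 1))" for i
  proof -
    have t: "mix_time i + real m \<ge> real m + 1" using mix_time_ge[of i] by linarith
    then have "heat (mix_time i + real m) (y + 5) \<le> (y + 5) / ((mix_time i + real m) * sqrt (mix_time i + real m))"
      using y by (intro heat_le) auto
    also have "\<dots> \<le> (y + 5) / ((real m + 1) * sqrt (real m + 1))"
      using t y by (intro divide_left_mono mult_mono mult_pos_pos) auto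
    finally show ?thesis .
  qed
  then have "killed_mix N \<epsilon> m y \<le> (\<Sum>i<N. mix_weight (1/4) i * ((y + 5) / ((real m + 1) * sqrt (real m + 1)))) + \<epsilon>"
    unfolding killed_mix_def by (intro add_right_mono sum_mono mult_left_mono mix_weight_nonneg)
  also have "\<dots> \<le> suminf (mix_weight (1/4)) * ((y + 5) / ((real m + 1) * sqrt (real m + 1))) + \<epsilon>"
    unfolding sum_distrib_right[symmetric] using y sum_mix_weight_le[of "1/4" N]
    by (intro add_right_mono mult_right_mono) auto
  finally show ?thesis .
qed

text \<open>For fixed \<open>n\<close> the comparison runs along the straight line from \<open>0\<close> to the expected position of the
  maximum; the growth of the first moment along it, \<open>growth n ^ n\<close>, is of the order \<open>n powr (3/2)\<close>.\<close>

definition slope :: "nat \<Rightarrow> real" where "slope n = crit - 3 / (2 * crit) * (ln (real n) / real n)"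

definition growth :: "nat \<Rightarrow> real" where "growth n = 2 * exp (- (slope n)\<^sup>2 / 2)"

lemma crit_bounds: "1 \<le> crit" "crit \<le> 2"
proof -
  have "1\<^sup>2 \<le> crit\<^sup>2" unfolding crit_sq using ln2_ge by simp
  then show "1 \<le> crit" by (rule power2_le_imp_le) (use crit_pos in simp)
  have "crit\<^sup>2 \<le> 2\<^sup>2" unfolding crit_sq using ln_2_less_1 by simp
  then show "crit \<le> 2" by (rule power2_le_imp_le) simp
qed

lemma slope_bounds:
  assumes n: "n \<ge> 1"
  shows "1/2 \<le> slope n" "slope n \<le> crit"
proof -
  have "ln (real n / 2) \<le> real n / 2 - 1" using n by (intro ln_le_minus_one) auto
  then have "ln (real n) \<le> real n / 2" using n ln_2_less_1 by (simp add: ln_div)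
  then have l: "ln (real n) / real n \<le> 1 / 2" using n by (simp add: field_simps)
  have "3 / (2 * crit) * (ln (real n) / real n) \<le> 3 / (2 * crit) * (1 / 2)"
    using l crit_pos by (intro mult_left_mono) auto
  also have "\<dots> \<le> crit - 1 / 2"
  proof -
    \<comment> \<open>\<open>577 / 500\<close> lies just below \<open>sqrt (4 / 3)\<close>, and
      \<open>crit\<^sup>2 \<ge> 4 / 3\<close> by \<open>ln 2 \<ge> 2 / 3\<close>. It suffices for
      \<open>crit * (crit - 1 / 2) \<ge> 3 / 4\<close>.\<close>
    have "577 / 500 \<le> crit"
    proof (rule power2_le_imp_le)
      show "(577 / 500)\<^sup>2 \<le> crit\<^sup>2"
        unfolding crit_sq using ln2_ge_two_thirds by (simp add: power2_eq_square)
    qed (use crit_pos in simp)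
    then have "577 / 500 * (577 / 500 - 1 / 2) \<le> crit * (crit - 1 / 2)" by (intro mult_mono) auto
    then have "3 / 4 \<le> crit * (crit - 1 / 2)" by simp
    then show ?thesis using crit_pos by (simp add: field_simps)
  qed
  finally show "1/2 \<le> slope n" by (simp add: slope_def)
  show "slope n \<le> crit" using n crit_pos by (simp add: slope_def)
qed

lemma growth_eq:
  "growth n = exp (3 / 2 * (ln (real n) / real n) - 9 / 8 * (ln (real n) / real n)\<^sup>2 / crit\<^sup>2)"
proof -
  define L where "L = ln (real n) / real n"
  have "(slope n)\<^sup>2 = crit\<^sup>2 - 3 * L + 9 / 4 * L\<^sup>2 / crit\<^sup>2"
    unfolding slope_def L_def[symmetric] using crit_pos by (simp add: power2_eq_square field_simps)
  then have "- (slope n)\<^sup>2 / 2 = - crit\<^sup>2 / 2 + (3 / 2 * L - 9 / 8 * L\<^sup>2 / crit\<^sup>2)"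
    by (simp add: field_simps)
  then show ?thesis using exp_crit by (simp only: growth_def exp_add L_def[symmetric]) (simp add: mult.assoc[symmetric])
qed

lemma growth_bounds: "0 < growth n" "growth n \<le> 2"
  by (auto simp: growth_def)

text \<open>At intermediate times \<open>growth n ^ j\<close> is at most about
  \<open>n powr (3/2 * j / n)\<close>, which stays below a multiple of \<open>j powr (3/2)\<close>
  because \<open>j / n * ln (n / j) \<le> 1\<close>.\<close>

lemma growth_pow_le:
  assumes "1 \<le> j" "j \<le> n"
  shows "growth n ^ j \<le> exp (3 / 2) * (real j * sqrt (real j))"
proof -
  have j: "real j > 0" "real n > 0" "real j \<le> real n" using assms by auto
  have "growth n \<le> exp (3 / 2 * (ln (real n) / real n))"
    unfolding growth_eq by simp
  then have "growth n ^ j \<le> exp (3 / 2 * (ln (real n) / real n)) ^ j"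
    using growth_bounds[of n] by (intro power_mono) auto
  also have "\<dots> = exp (3 / 2 * (real j / real n * ln (real n)))"
    by (simp add: exp_of_nat_mult[symmetric] field_simps)
  also have "\<dots> \<le> exp (3 / 2 * (ln (real j) + 1))"
  proof -
    have "ln (real n) = ln (real j) + ln (real n / real j)" using j by (simp add: ln_div)
    then have "real j / real n * ln (real n) = real j / real n * ln (real j) + real j / real n * ln (real n / real j)"
      by (simp only: distrib_left)
    also have "\<dots> \<le> 1 * ln (real j) + real j / real n * (real n / real j)"
      using j assms by (intro add_mono mult_right_mono mult_left_mono ln_bound) auto
    also have "\<dots> = ln (real j) + 1" using j by simp
    finally show ?thesis by simp
  qed
  also have "\<dots> = exp (3 / 2) * (real j * sqrt (real j))"
  proof -
    have "exp (ln (real j) / 2) = sqrt (real j)"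
      using j by (intro real_sqrt_unique[symmetric]) (simp_all add: power2_eq_square exp_add[symmetric])
    moreover have "3 / 2 * (ln (real j) + 1) = 3 / 2 + (ln (real j) + ln (real j) / 2)" by simp
    ultimately show ?thesis using j by (simp only: exp_add) simp
  qed
  finally show ?thesis .
qed

text \<open>The quadratic term of the exponent costs only a constant, since
  \<open>(ln n)\<^sup>2 \<le> 4 * n\<close>.\<close>

lemma growth_pow_ge:
  assumes "n \<ge> 1"
  shows "real n * sqrt (real n) * exp (- 4) \<le> growth n ^ n"
proof -
  have n: "real n > 0" using assms by simp
  have "ln (sqrt (real n)) \<le> sqrt (real n)" using n by (intro ln_bound) auto
  then have "ln (real n) \<le> 2 * sqrt (real n)" using n by (simp add: ln_sqrt)
  then have "(ln (real n))\<^sup>2 \<le> (2 * sqrt (real n))\<^sup>2" using assms by (intro power_mono) auto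
  then have l: "(ln (real n))\<^sup>2 \<le> 4 * real n" using n by (simp add: power_mult_distrib)
  have "9 / 8 * ((ln (real n))\<^sup>2 / real n) / crit\<^sup>2 \<le> 9 / 8 * 4 / (9 / 8)"
    unfolding crit_sq using l n ln2_ge by (intro frac_le mult_left_mono) (auto simp: field_simps)
  then have 1: "9 / 8 * ((ln (real n))\<^sup>2 / real n) / crit\<^sup>2 \<le> 4" by simp
  have "growth n ^ n = exp (real n * (3 / 2 * (ln (real n) / real n) - 9 / 8 * (ln (real n) / real n)\<^sup>2 / crit\<^sup>2))"
    unfolding growth_eq by (simp add: exp_of_nat_mult[symmetric])
  also have "real n * (3 / 2 * (ln (real n) / real n) - 9 / 8 * (ln (real n) / real n)\<^sup>2 / crit\<^sup>2)
    = ln (real n) + ln (real n) / 2 + - (9 / 8 * ((ln (real n))\<^sup>2 / real n) / crit\<^sup>2)"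
    using n by (simp add: power2_eq_square field_simps)
  also have "exp \<dots> \<ge> exp (ln (real n) + ln (real n) / 2 + - 4)" using 1 by simp
  also have "exp (ln (real n) + ln (real n) / 2 + - 4) = real n * sqrt (real n) * exp (- 4)"
  proof -
    have "exp (ln (real n) / 2) = sqrt (real n)"
      using n by (intro real_sqrt_unique[symmetric]) (simp_all add: power2_eq_square exp_add[symmetric])
    then show ?thesis using n by (simp only: exp_add) simp
  qed
  finally show ?thesis .
qed

text \<open>Bounds the pairs of particles by their last common ancestor, whose children have
  \<open>j\<close> generations left. The squared first moment contributes
  \<open>growth n ^ (2 * j) / j ^ 3\<close>; one further factor \<open>growth n\<close> is kept for
  the branching step and one for each of the \<open>k - 1 - j\<close> generations before it.\<close>

definition correction :: "nat \<Rightarrow> nat \<Rightarrow> real \<Rightarrow> nat \<Rightarrow> real \<Rightarrow> real" where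
  "correction n N \<epsilon> k z = (\<Sum>j\<in>{1..<k}. growth n ^ (k + j) / real j ^ 3 * killed_mix N \<epsilon> (k - 1 - j) z)"

lemma correction_integrable: "integrable lborel (\<lambda>h. std_normal_density h * correction n N \<epsilon> k (z - h))"
  unfolding correction_def sum_distrib_left
proof (rule Bochner_Integration.integrable_sum)
  fix j
  show "integrable lborel (\<lambda>h. std_normal_density h * (growth n ^ (k + j) / real j ^ 3 * killed_mix N \<epsilon> (k - 1 - j) (z - h)))"
    using integrable_mult_right[OF killed_mix_integrable[of N \<epsilon> "k - 1 - j" z], of "growth n ^ (k + j) / real j ^ 3"]
    by (simp only: mult_ac)
qed

lemma correction_nonneg: "correction n N \<epsilon> k z \<ge> 0" if "\<epsilon> \<ge> 0" "z \<ge> 0"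
  unfolding correction_def using that growth_bounds(1)[of n]
  by (intro sum_nonneg mult_nonneg_nonneg killed_mix_nonneg) auto

text \<open>The comparison starts at generation one, since \<open>heat\<close> needs positive
  variance. Variance \<open>1 / 2\<close> makes the profile decay like
  \<open>exp (- z\<^sup>2)\<close>, fast enough to lie below the shifted normal density:
  \<open>(z + 3)\<^sup>2 \<le> 3 / 2 * z\<^sup>2 + 27\<close>. This is the origin of
  \<open>27 / 2\<close>; the \<open>8\<close> is \<open>2\<close> for the growth times
  \<open>4 \<ge> 2 * sqrt 2\<close>.\<close>

lemma hom_tail_1_ge:
  assumes n: "n \<ge> 1" and z: "z \<ge> 0" and l: "0 \<le> \<alpha>" "\<alpha> \<le> exp (- 27 / 2) / (8 * sqrt (2 * pi))"
  shows "exp (- slope n * z) * (\<alpha> * growth n * heat (1 / 2) z) \<le> hom_tail 1 (slope n + z)"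
proof -
  define s where "s = slope n"
  have s: "0 \<le> s" "s \<le> 2" using slope_bounds[OF n] crit_bounds by (auto simp: s_def)
  define x where "x = s + z"
  have x: "x \<ge> 0" using s z by (simp add: x_def)
  have "std_normal_density (x + 1) = (\<integral>h. indicator {x<..x + 1} h * std_normal_density (x + 1) \<partial>lborel)"
    by simp
  also have "\<dots> \<le> (\<integral>h. std_normal_density h * neg_ind (x - h) \<partial>lborel)"
  proof (rule integral_mono)
    show "integrable lborel (\<lambda>h. indicator {x<..x + 1} h * std_normal_density (x + 1))" by simp
    show "integrable lborel (\<lambda>h. std_normal_density h * neg_ind (x - h))"
      using tail_fun_integrable[OF tail_fun_neg_ind, of x 1] by simp
    fix h
    have "std_normal_density (x + 1) \<le> std_normal_density h" if "x < h" "h \<le> x + 1"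
      unfolding std_normal_density_def using that x by (intro mult_left_mono) (auto intro: power_mono)
    then show "indicator {x<..x + 1} h * std_normal_density (x + 1) \<le> std_normal_density h * neg_ind (x - h)"
      by (auto simp: neg_ind_def split: split_indicator)
  qed
  finally have g: "std_normal_density (x + 1) \<le> gauss_avg neg_ind x" by (simp add: gauss_avg_def)
  have "gauss_avg neg_ind x \<le> 1" "0 \<le> gauss_avg neg_ind x"
    using tail_fun_avg[OF tail_fun_neg_ind, of x 1] by (simp_all add: gauss_avg_def)
  then have "gauss_avg neg_ind x * gauss_avg neg_ind x \<le> gauss_avg neg_ind x * 1" by (intro mult_left_mono) auto
  then have "gauss_avg neg_ind x \<le> branch 1 neg_ind x"
    unfolding branch_1 by (simp add: power2_eq_square algebra_simps)
  with g have g: "std_normal_density (x + 1) \<le> hom_tail 1 x" by simp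
  have "z \<le> 1 + z\<^sup>2 / 4" using sum_squares_ge_zero[of "z / 2 - 1" 0] by (simp add: power2_eq_square algebra_simps)
  also have "\<dots> \<le> exp (z\<^sup>2 / 4)" by (rule exp_ge_add_one_self)
  finally have zz: "z \<le> exp (z\<^sup>2 / 4)" .
  have "heat (1 / 2) z = z * exp (- z\<^sup>2) * (2 * sqrt 2)"
    by (simp add: heat_def real_sqrt_divide)
  also have "\<dots> \<le> exp (z\<^sup>2 / 4) * exp (- z\<^sup>2) * 4"
    using zz z sqrt2_less_2 by (intro mult_mono) auto
  also have "exp (z\<^sup>2 / 4) * exp (- z\<^sup>2) = exp (- (3 / 4) * z\<^sup>2)" by (simp add: exp_add[symmetric])
  finally have h: "heat (1 / 2) z \<le> exp (- (3 / 4) * z\<^sup>2) * 4" .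
  have "exp (- s * z) * (\<alpha> * growth n * heat (1 / 2) z) \<le> 1 * (exp (- 27 / 2) / (8 * sqrt (2 * pi)) * 2 * (exp (- (3 / 4) * z\<^sup>2) * 4))"
    using s z l growth_bounds[of n] h heat_nonneg[of "1/2" z]
    by (intro mult_mono mult_nonneg_nonneg) auto
  also have "\<dots> = exp (- 27 / 2 + - (3 / 4) * z\<^sup>2) / sqrt (2 * pi)"
    unfolding exp_add by simp
  also have "\<dots> \<le> std_normal_density (x + 1)"
  proof -
    have "(x + 1)\<^sup>2 \<le> (z + 3)\<^sup>2" using s z by (intro power_mono) (auto simp: x_def)
    also have "\<dots> \<le> 3 / 2 * z\<^sup>2 + 27"
      using sum_squares_ge_zero[of "z - 6" 0] by (simp add: power2_eq_square algebra_simps)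
    finally show ?thesis unfolding std_normal_density_def
      by (auto intro!: divide_right_mono)
  qed
  finally show ?thesis using g by (simp add: s_def x_def)
qed

text \<open>The gain is linear in \<open>\<alpha>\<close> and the loss quadratic, so a small
  \<open>\<alpha>\<close> will let the first moment win.\<close>

lemma hom_tail_lower_step:
  fixes N :: nat
  assumes n: "n \<ge> 1" and l: "0 \<le> \<alpha>" "\<alpha> \<le> exp (- 27 / 2) / (8 * sqrt (2 * pi))"
    and k: "k \<ge> 1" and z: "z \<ge> 0"
  defines "\<epsilon> \<equiv> exp (- 1 / 4 * real N)"
  shows "exp (- slope n * z) * (\<alpha> * growth n ^ k * heat (real k - 1 / 2) z - \<alpha>\<^sup>2 * 512 * correction n N \<epsilon> k z)
    \<le> hom_tail k (slope n * real k + z)"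
  using k z
proof (induction k arbitrary: z rule: nat_induct_at_least)
  case base
  then show ?case using hom_tail_1_ge[OF n _ l, of z] by (simp add: correction_def)
next
  case (Suc k)
  define \<rho> where "\<rho> = growth n"
  define s where "s = slope n"
  have \<rho>: "0 < \<rho>" "\<rho> \<le> 2" using growth_bounds by (auto simp: \<rho>_def)
  have \<epsilon>: "\<epsilon> \<ge> 0" by (simp add: \<epsilon>_def)
  have t: "real k - 1 / 2 > 0" using Suc.hyps by simp
  have z: "z \<ge> 0" by fact
  let ?A = "\<lambda>z. \<alpha> * \<rho> ^ k * heat (real k - 1 / 2) z"
  let ?B = "\<lambda>z. \<alpha>\<^sup>2 * 512 * correction n N \<epsilon> k z"
  define H where "H = (\<integral>h. std_normal_density h * (indicator {..z} h * heat (real k - 1 / 2) (z - h)) \<partial>lborel)"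
  define P where "P = (\<integral>h. std_normal_density h * (indicator {..z} h * ?A (z - h)) \<partial>lborel)"
  define R where "R = (\<integral>h. std_normal_density h * (indicator {..z} h * ?B (z - h)) \<partial>lborel)"
  define \<Psi> where "\<Psi> j = (\<integral>h. std_normal_density h * (indicator {..z} h * killed_mix N \<epsilon> (k - 1 - j) (z - h)) \<partial>lborel)" for j
  have step: "exp (- s * z) * (\<rho> * P - (\<rho> * R + \<rho>\<^sup>2 / 4 * exp (- s * z) * P\<^sup>2)) \<le> branch 1 (hom_tail k) (s * real k + s + z)"
    unfolding P_def R_def \<rho>_def growth_def s_def[symmetric]
  proof (rule branch_lower_step)
    show "tail_fun (hom_tail k)" by (intro tail_fun_funpow tail_fun_neg_ind)
    show "exp (- s * y) * (\<alpha> * (2 * exp (- s\<^sup>2 / 2)) ^ k * heat (real k - 1 / 2) y - ?B y) \<le> hom_tail k (s * real k + y)" if "y \<ge> 0" for y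
      using Suc.IH[OF that] by (simp add: s_def growth_def)
    show "integrable lborel (\<lambda>h. std_normal_density h * (\<alpha> * (2 * exp (- s\<^sup>2 / 2)) ^ k * heat (real k - 1 / 2) (z - h)))"
      using integrable_mult_right[OF integrable_gauss_heat[OF t, of z], of "\<alpha> * (2 * exp (- s\<^sup>2 / 2)) ^ k"]
      by (simp only: mult_ac)
    show "integrable lborel (\<lambda>h. std_normal_density h * ?B (z - h))"
      using integrable_mult_right[OF correction_integrable[of n N \<epsilon> k z], of "\<alpha>\<^sup>2 * 512"] by (simp only: mult_ac)
    show "0 \<le> \<alpha> * (2 * exp (- s\<^sup>2 / 2)) ^ k * heat (real k - 1 / 2) y" if "y \<ge> 0" for y
      using l(1) t that by (intro mult_nonneg_nonneg heat_nonneg) auto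
    show "0 \<le> ?B y" if "y \<ge> 0" for y
      using correction_nonneg[OF \<epsilon> that] by (intro mult_nonneg_nonneg) auto
  qed
  have PH: "P = \<alpha> * \<rho> ^ k * H"
    unfolding P_def H_def by (simp add: mult_ac flip: integral_mult_right_zero)
  have H1: "heat (real (Suc k) - 1 / 2) z \<le> H"
    using heat_restrict_ge[OF t, of z] by (simp add: H_def)
  have H0: "0 \<le> H" using heat_nonneg[of "real (Suc k) - 1 / 2" z] H1 z by simp
  have H2: "H\<^sup>2 \<le> 8 / real k ^ 3 * (z + 1)\<^sup>2"
  proof -
    have "H \<le> (z + 1) / ((real k - 1 / 2) * sqrt (real k - 1 / 2))"
      unfolding H_def by (rule heat_restrict_le[OF t z])
    then have "H\<^sup>2 \<le> ((z + 1) / ((real k - 1 / 2) * sqrt (real k - 1 / 2)))\<^sup>2"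
      using H0 by (intro power_mono)
    also have "\<dots> = (z + 1)\<^sup>2 / (real k - 1 / 2) ^ 3"
      using t by (simp add: power_divide power_mult_distrib power3_eq_cube power2_eq_square)
    also have "\<dots> \<le> (z + 1)\<^sup>2 / (real k / 2) ^ 3"
      using Suc.hyps by (intro divide_left_mono power_mono mult_pos_pos) auto
    also have "\<dots> = 8 / real k ^ 3 * (z + 1)\<^sup>2" by (simp add: power_divide)
    finally show ?thesis .
  qed
  have "\<rho>\<^sup>2 / 4 * exp (- s * z) * P\<^sup>2 \<le> \<alpha>\<^sup>2 * 512 * (\<rho> ^ (Suc k + k) / real k ^ 3 * killed_mix N \<epsilon> 0 z)"
  proof -
    have "exp (- s * z) * H\<^sup>2 \<le> exp (- s * z) * (8 / real k ^ 3 * (z + 1)\<^sup>2)"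
      by (intro mult_left_mono H2) auto
    also have "\<dots> = 8 / real k ^ 3 * ((z + 1)\<^sup>2 * exp (- s * z))" by simp
    also have "\<dots> \<le> 8 / real k ^ 3 * (128 * killed_mix N \<epsilon> 0 z)"
      unfolding \<epsilon>_def using slope_bounds(1)[OF n] z by (intro mult_left_mono killed_mix_0_ge) (auto simp: s_def)
    finally have 1: "exp (- s * z) * H\<^sup>2 \<le> 1024 / real k ^ 3 * killed_mix N \<epsilon> 0 z" by simp
    have "\<rho>\<^sup>2 / 4 * exp (- s * z) * P\<^sup>2 = (\<rho> / 2 * (\<rho> / 2)) * \<alpha>\<^sup>2 * \<rho> ^ (k + k) * (exp (- s * z) * H\<^sup>2)"
      unfolding PH by (simp add: power_mult_distrib power_add power2_eq_square)
    \<comment> \<open>One factor \<open>\<rho> / 2\<close> is bounded by \<open>1\<close>, the other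
      is kept to give the power \<open>Suc k + k\<close> and to turn \<open>1024\<close> into
      \<open>512\<close>.\<close>
    also have "\<dots> \<le> (\<rho> / 2 * 1) * \<alpha>\<^sup>2 * \<rho> ^ (k + k) * (1024 / real k ^ 3 * killed_mix N \<epsilon> 0 z)"
      using \<rho> by (intro mult_mono 1 mult_nonneg_nonneg) auto
    also have "\<dots> = \<alpha>\<^sup>2 * 512 * (\<rho> ^ (Suc k + k) / real k ^ 3 * killed_mix N \<epsilon> 0 z)" by simp
    finally show ?thesis .
  qed
  moreover have "\<rho> * R \<le> \<alpha>\<^sup>2 * 512 * (\<Sum>j\<in>{1..<k}. \<rho> ^ (Suc k + j) / real j ^ 3 * killed_mix N \<epsilon> (k - j) z)"
  proof -
    have i: "integrable lborel (\<lambda>h. std_normal_density h * (indicator {..z} h * killed_mix N \<epsilon> (k - 1 - j) (z - h)))" for j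
      by (rule integrable_gauss_ind[OF killed_mix_integrable])
    have "R = (\<integral>h. \<alpha>\<^sup>2 * 512 * (\<Sum>j\<in>{1..<k}. \<rho> ^ (k + j) / real j ^ 3 * (std_normal_density h * (indicator {..z} h * killed_mix N \<epsilon> (k - 1 - j) (z - h)))) \<partial>lborel)"
      unfolding R_def correction_def sum_distrib_left \<rho>_def by (simp only: mult_ac)
    also have "\<dots> = \<alpha>\<^sup>2 * 512 * (\<Sum>j\<in>{1..<k}. \<rho> ^ (k + j) / real j ^ 3 * \<Psi> j)"
      unfolding \<Psi>_def using i by simp
    also have "\<dots> \<le> \<alpha>\<^sup>2 * 512 * (\<Sum>j\<in>{1..<k}. \<rho> ^ (k + j) / real j ^ 3 * killed_mix N \<epsilon> (k - j) z)"
    proof (intro mult_left_mono sum_mono)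
      fix j assume j: "j \<in> {1..<k}"
      then have "Suc (k - 1 - j) = k - j" by auto
      then show "\<Psi> j \<le> killed_mix N \<epsilon> (k - j) z"
        unfolding \<Psi>_def using killed_mix_step[OF \<epsilon> z, of N "k - 1 - j"] by simp
    qed (use \<rho> in auto)
    finally have "\<rho> * R \<le> \<rho> * (\<alpha>\<^sup>2 * 512 * (\<Sum>j\<in>{1..<k}. \<rho> ^ (k + j) / real j ^ 3 * killed_mix N \<epsilon> (k - j) z))"
      using \<rho> by (intro mult_left_mono) auto
    also have "\<dots> = \<alpha>\<^sup>2 * 512 * (\<Sum>j\<in>{1..<k}. \<rho> ^ (Suc k + j) / real j ^ 3 * killed_mix N \<epsilon> (k - j) z)"
      by (simp add: sum_distrib_left mult_ac)
    finally show ?thesis .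
  qed
  moreover have "correction n N \<epsilon> (Suc k) z = (\<Sum>j\<in>{1..<k}. \<rho> ^ (Suc k + j) / real j ^ 3 * killed_mix N \<epsilon> (k - j) z) + \<rho> ^ (Suc k + k) / real k ^ 3 * killed_mix N \<epsilon> 0 z"
    unfolding correction_def \<rho>_def using Suc.hyps by (simp add: sum.atLeastLessThan_Suc)
  ultimately have C: "\<rho> * R + \<rho>\<^sup>2 / 4 * exp (- s * z) * P\<^sup>2 \<le> \<alpha>\<^sup>2 * 512 * correction n N \<epsilon> (Suc k) z"
    by (simp only: distrib_left)
  have "\<alpha> * \<rho> ^ Suc k * heat (real (Suc k) - 1 / 2) z \<le> \<alpha> * \<rho> ^ Suc k * H"
    using l \<rho> by (intro mult_left_mono H1) auto
  also have "\<dots> = \<rho> * P" unfolding PH by simp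
  finally have "\<alpha> * \<rho> ^ Suc k * heat (real (Suc k) - 1 / 2) z \<le> \<rho> * P" .
  with C have "\<alpha> * \<rho> ^ Suc k * heat (real (Suc k) - 1 / 2) z - \<alpha>\<^sup>2 * 512 * correction n N \<epsilon> (Suc k) z
    \<le> \<rho> * P - (\<rho> * R + \<rho>\<^sup>2 / 4 * exp (- s * z) * P\<^sup>2)" by linarith
  then have "exp (- s * z) * (\<alpha> * \<rho> ^ Suc k * heat (real (Suc k) - 1 / 2) z - \<alpha>\<^sup>2 * 512 * correction n N \<epsilon> (Suc k) z)
    \<le> exp (- s * z) * (\<rho> * P - (\<rho> * R + \<rho>\<^sup>2 / 4 * exp (- s * z) * P\<^sup>2))" by (rule mult_left_mono) simp
  also note step
  finally show ?case by (simp add: s_def \<rho>_def distrib_left add_ac)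
qed

section \<open>Summing the quadratic losses\<close>

definition zeta32 :: real where "zeta32 = (\<Sum>j. 1 / (real (Suc j) * sqrt (real (Suc j))))"

lemma summable_zeta32: "summable (\<lambda>j. 1 / (real (Suc j) * sqrt (real (Suc j))))"
proof (rule summable_comparison_test_bigo)
  show "summable (\<lambda>n. norm (real n powr (-3/2)))" by (simp add: summable_real_powr_iff)
  show "(\<lambda>j. 1 / (real (Suc j) * sqrt (real (Suc j)))) \<in> O(\<lambda>n. real n powr (-3/2))" by real_asymp
qed

lemma sum_zeta32_le:
  "(\<Sum>j\<in>{1..<n}. 1 / (real j * sqrt (real j))) \<le> zeta32"
  "(\<Sum>j\<in>{1..<n}. 1 / (real (n - j) * sqrt (real (n - j)))) \<le> zeta32"
proof -
  have "(\<Sum>j\<in>{1..<n}. 1 / (real j * sqrt (real j))) = (\<Sum>j<n - 1. 1 / (real (Suc j) * sqrt (real (Suc j))))"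
    by (rule sum.reindex_bij_witness[of _ Suc "\<lambda>j. j - 1"]) auto
  also have "\<dots> \<le> zeta32"
    unfolding zeta32_def by (intro sum_le_suminf summable_zeta32) auto
  finally show 1: "(\<Sum>j\<in>{1..<n}. 1 / (real j * sqrt (real j))) \<le> zeta32" .
  have "(\<Sum>j\<in>{1..<n}. 1 / (real (n - j) * sqrt (real (n - j)))) = (\<Sum>j\<in>{1..<n}. 1 / (real j * sqrt (real j)))"
    by (rule sum.reindex_bij_witness[of _ "\<lambda>j. n - j" "\<lambda>j. n - j"]) auto
  with 1 show "(\<Sum>j\<in>{1..<n}. 1 / (real (n - j) * sqrt (real (n - j)))) \<le> zeta32" by simp
qed

text \<open>The larger of \<open>j\<close> and \<open>n - j\<close> is at least
  \<open>n / 2\<close>, and \<open>2 powr (3/2) \<le> 4\<close>; so one of the two summands already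
  suffices.\<close>

lemma three_halves_split:
  assumes "1 \<le> j" "j < n"
  shows "real n * sqrt (real n) / (real j * sqrt (real j) * (real (n - j) * sqrt (real (n - j))))
    \<le> 4 * (1 / (real j * sqrt (real j)) + 1 / (real (n - j) * sqrt (real (n - j))))"
proof -
  define f where "f x = x * sqrt x" for x :: real
  have aux: "f (a + b) / (f a * f b) \<le> 4 * (1 / f a)" if "0 < a" "a \<le> b" for a b
  proof -
    have "f (a + b) \<le> f (2 * b)" unfolding f_def using that by (intro mult_mono) auto
    also have "\<dots> \<le> 4 * f b" unfolding f_def real_sqrt_mult using that sqrt2_less_2
      by (simp add: mult_ac mult_left_mono)
    finally have "f (a + b) / (f a * f b) \<le> 4 * f b / (f a * f b)"
      using that by (intro divide_right_mono) (auto simp: f_def)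
    also have "\<dots> = 4 * (1 / f a)" using that by (simp add: f_def)
    finally show ?thesis .
  qed
  define a b where "a = real j" and "b = real (n - j)"
  have ab: "a > 0" "b > 0" "real n = a + b" using assms by (auto simp: a_def b_def)
  have "f (a + b) / (f a * f b) \<le> 4 * (1 / f a + 1 / f b)"
  proof (cases "a \<le> b")
    case True
    have "0 \<le> 1 / f b" using ab by (simp add: f_def)
    then show ?thesis using aux[OF ab(1) True] by (simp only: distrib_left)
  next
    case False
    have "0 \<le> 1 / f a" using ab by (simp add: f_def)
    then show ?thesis using aux[OF ab(2), of a] False by (simp only: add.commute[of b] mult.commute[of "f b"] distrib_left) linarith
  qed
  then show ?thesis unfolding f_def a_def[symmetric] b_def[symmetric] ab(3) .
qed

text \<open>The growth factors give \<open>n powr (3/2) * j powr (3/2)\<close>, against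
  \<open>j ^ 3\<close> from the squared profile and \<open>(n - j) powr (3/2)\<close> from
  \<open>killed_mix\<close>. After the split this is a sum of order \<open>zeta32\<close>, uniformly
  in \<open>n\<close>.\<close>

lemma correction_le:
  obtains C where "C > 0" "\<And>n N \<epsilon>. n \<ge> 1 \<Longrightarrow> 0 \<le> \<epsilon> \<Longrightarrow> \<epsilon> \<le> 1 / (real n * sqrt (real n)) \<Longrightarrow> correction n N \<epsilon> n 1 \<le> C"
proof -
  \<comment> \<open>\<open>6\<close> is \<open>y + 5\<close> at \<open>y = 1\<close>; the added
    \<open>1\<close> covers \<open>\<epsilon>\<close>.\<close>
  define Q where "Q = suminf (mix_weight (1/4)) * 6 + 1"
  have "suminf (mix_weight (1/4)) \<ge> 0" by (intro suminf_nonneg summable_mix_weight mix_weight_nonneg) auto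
  then have Q: "Q > 0" by (simp add: Q_def)
  define E where "E = exp (3 / 2) * exp (3 / 2 :: real) * Q"
  have E: "E > 0" using Q by (simp add: E_def)
  show thesis
  proof
    show "E * (4 * (zeta32 + zeta32)) + 1 > 0"
      using E sum_zeta32_le(1)[of 1] by (intro add_nonneg_pos) auto
    fix n N :: nat and \<epsilon> :: real
    assume n: "n \<ge> 1" and \<epsilon>: "0 \<le> \<epsilon>" "\<epsilon> \<le> 1 / (real n * sqrt (real n))"
    have "correction n N \<epsilon> n 1 \<le> (\<Sum>j\<in>{1..<n}. E * (4 * (1 / (real j * sqrt (real j)) + 1 / (real (n - j) * sqrt (real (n - j))))))"
      unfolding correction_def
    proof (rule sum_mono)
      fix j assume "j \<in> {1..<n}"
      then have j: "1 \<le> j" "j < n" by auto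
      define J M where "J = real j * sqrt (real j)" and "M = real (n - j) * sqrt (real (n - j))"
      have J: "J > 0" "M > 0" using j by (auto simp: J_def M_def)
      have JJ: "J * J = real j ^ 3" by (simp add: J_def power3_eq_cube)
      have eqn: "real (n - 1 - j) + 1 = real (n - j)" using j by (simp add: of_nat_diff)
      have "killed_mix N \<epsilon> (n - 1 - j) 1 \<le> suminf (mix_weight (1/4)) * (6 / M) + \<epsilon>"
        using killed_mix_le[of 1 N \<epsilon> "n - 1 - j"] unfolding eqn M_def by simp
      also have "\<epsilon> \<le> 1 / M"
      proof -
        have "M \<le> real n * sqrt (real n)" unfolding M_def by (intro mult_mono) auto
        then have "1 / (real n * sqrt (real n)) \<le> 1 / M" using J n by (intro divide_left_mono) auto
        with \<epsilon> show ?thesis by simp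
      qed
      finally have p: "killed_mix N \<epsilon> (n - 1 - j) 1 \<le> Q / M" by (simp add: Q_def add_divide_distrib)
      have "growth n ^ (n + j) \<le> (exp (3 / 2) * (real n * sqrt (real n))) * (exp (3 / 2) * J)"
        unfolding power_add J_def using growth_pow_le[of n n] growth_pow_le[of j n] j n growth_bounds[of n]
        by (intro mult_mono) auto
      then have "growth n ^ (n + j) / real j ^ 3 * killed_mix N \<epsilon> (n - 1 - j) 1
        \<le> (exp (3 / 2) * (real n * sqrt (real n))) * (exp (3 / 2) * J) / real j ^ 3 * (Q / M)"
        using p killed_mix_nonneg[OF \<epsilon>(1), of 1] J Q growth_bounds[of n]
        by (intro mult_mono divide_right_mono) auto
      also have "\<dots> = E * (real n * sqrt (real n) / (J * M))"
        unfolding JJ[symmetric] E_def using J by (simp add: field_simps)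
      also have "\<dots> \<le> E * (4 * (1 / J + 1 / M))"
        unfolding J_def M_def using E by (intro mult_left_mono three_halves_split j) auto
      finally show "growth n ^ (n + j) / real j ^ 3 * killed_mix N \<epsilon> (n - 1 - j) 1
        \<le> E * (4 * (1 / (real j * sqrt (real j)) + 1 / (real (n - j) * sqrt (real (n - j)))))"
        unfolding J_def M_def .
    qed
    also have "\<dots> = E * (4 * ((\<Sum>j\<in>{1..<n}. 1 / (real j * sqrt (real j))) + (\<Sum>j\<in>{1..<n}. 1 / (real (n - j) * sqrt (real (n - j))))))"
      by (simp only: sum_distrib_left[symmetric] sum.distrib)
    also have "\<dots> \<le> E * (4 * (zeta32 + zeta32))"
      using E sum_zeta32_le[of n] by (intro mult_left_mono add_mono) auto
    finally show "correction n N \<epsilon> n 1 \<le> E * (4 * (zeta32 + zeta32)) + 1" by simp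
  qed
qed

definition mean_pos :: "nat \<Rightarrow> real" where
  "mean_pos n = crit * real n - 3 / (2 * crit) * ln (real n)"

lemma hom_tail_lower:
  obtains \<delta> where "0 < \<delta>" "\<delta> \<le> 1" "\<And>n. n \<ge> 1 \<Longrightarrow> \<delta> \<le> hom_tail n (mean_pos n + 1)"
proof -
  obtain C where C: "C > 0" "\<And>n N \<epsilon>. n \<ge> 1 \<Longrightarrow> 0 \<le> \<epsilon> \<Longrightarrow> \<epsilon> \<le> 1 / (real n * sqrt (real n)) \<Longrightarrow> correction n N \<epsilon> n 1 \<le> C"
    using correction_le by metis
  \<comment> \<open>The first bound permits the start at generation one. The second keeps the loss
    below half of the gain, whose lower bound \<open>exp (- 5)\<close> combines
    \<open>exp (- 4)\<close> from the growth and \<open>exp (- 1)\<close> from the profile at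
    distance \<open>1\<close>.\<close>
  define \<alpha> where "\<alpha> = min (exp (- 27 / 2) / (8 * sqrt (2 * pi))) (exp (- 5) / (1024 * C))"
  have l: "\<alpha> > 0" "\<alpha> \<le> exp (- 27 / 2) / (8 * sqrt (2 * pi))" using C by (auto simp: \<alpha>_def)
  have "\<alpha> \<le> exp (- 5) / (1024 * C)" by (simp add: \<alpha>_def)
  then have lC: "512 * (\<alpha> * C) \<le> exp (- 5) / 2" using C by (simp add: field_simps)
  define \<delta> where "\<delta> = exp (- crit) * (\<alpha> * (exp (- 5) / 2))"
  have d: "\<delta> > 0" using l by (simp add: \<delta>_def)
  have main: "\<delta> \<le> hom_tail n (mean_pos n + 1)" if n: "n \<ge> 1" for n
  proof -
    have "(\<lambda>N. exp (- 1 / 4 * real N)) \<longlonglongrightarrow> 0" by real_asymp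
    then have "eventually (\<lambda>N. exp (- 1 / 4 * real N) < 1 / (real n * sqrt (real n))) sequentially"
      using n by (intro order_tendstoD) auto
    then obtain N where N: "exp (- 1 / 4 * real N) < 1 / (real n * sqrt (real n))"
      using eventually_happens'[OF sequentially_bot] by blast
    define \<epsilon> where "\<epsilon> = exp (- 1 / 4 * real N)"
    have cl: "correction n N \<epsilon> n 1 \<le> C" using N by (intro C(2) n) (auto simp: \<epsilon>_def)
    have t: "real n - 1 / 2 > 0" using n by simp
    have "exp (- 1) / (real n * sqrt (real n)) \<le> heat (real n - 1 / 2) 1"
      unfolding heat_def using n by (intro frac_le mult_mono) (auto simp: field_simps)
    then have "real n * sqrt (real n) * exp (- 4) * (exp (- 1) / (real n * sqrt (real n))) \<le> growth n ^ n * heat (real n - 1 / 2) 1"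
      using growth_bounds[of n] by (intro mult_mono growth_pow_ge[OF n]) auto
    also have "real n * sqrt (real n) * exp (- 4) * (exp (- 1) / (real n * sqrt (real n))) = exp (- 4) * exp (- 1)"
      using n by simp
    also have "exp (- 4) * exp (- 1) = exp (- 5 :: real)" by (simp add: exp_add[symmetric])
    finally have a: "exp (- 5) \<le> growth n ^ n * heat (real n - 1 / 2) 1" .
    have "\<alpha> * (exp (- 5) / 2) \<le> \<alpha> * (exp (- 5) - 512 * (\<alpha> * C))"
      using l lC by (intro mult_left_mono) auto
    also have "\<dots> = \<alpha> * exp (- 5) - \<alpha>\<^sup>2 * 512 * C" by (simp add: power2_eq_square algebra_simps)
    also have "\<dots> \<le> \<alpha> * (growth n ^ n * heat (real n - 1 / 2) 1) - \<alpha>\<^sup>2 * 512 * correction n N \<epsilon> n 1"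
      using l a cl by (intro diff_mono mult_left_mono) auto
    finally have "exp (- crit) * (\<alpha> * (exp (- 5) / 2)) \<le> exp (- slope n * 1) * (\<alpha> * (growth n ^ n * heat (real n - 1 / 2) 1) - \<alpha>\<^sup>2 * 512 * correction n N \<epsilon> n 1)"
      using slope_bounds[OF n] l by (intro mult_mono) auto
    also have "\<dots> \<le> hom_tail n (slope n * real n + 1)"
      using hom_tail_lower_step[OF n _ l(2) n, of 1 N] l(1) by (simp add: \<epsilon>_def mult.assoc)
    also have "slope n * real n = mean_pos n" using n by (simp add: slope_def mean_pos_def field_simps)
    finally show ?thesis by (simp add: \<delta>_def)
  qed
  have "\<delta> \<le> 1" using main[of 1] tail_funD[OF tail_fun_funpow[OF tail_fun_neg_ind, of 1 1]] by (meson order_refl order_trans)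
  with d main show thesis using that by blast
qed

subsection \<open>Tightness from below\<close>

text \<open>Chebyshev's inequality.\<close>

lemma gauss_left_tail:
  assumes "L > 0"
  shows "(\<integral>h. std_normal_density h * indicator {..<- L} h \<partial>lborel) \<le> 1 / L\<^sup>2"
proof -
  have "(\<integral>h. std_normal_density h * indicator {..<- L} h \<partial>lborel) \<le> (\<integral>h. 1 / L\<^sup>2 * (std_normal_density h * h ^ 2) \<partial>lborel)"
  proof (rule integral_mono')
    show "integrable lborel (\<lambda>h. 1 / L\<^sup>2 * (std_normal_density h * h ^ 2))"
      by (intro integrable_mult_right integrable_std_normal_moment)
    fix h
    have "indicator {..<- L} h \<le> 1 / L\<^sup>2 * h\<^sup>2"
    proof (cases "h < - L")
      case True
      then have "L\<^sup>2 \<le> (- h)\<^sup>2" using assms by (intro power_mono) auto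
      then show ?thesis using True assms by (simp add: field_simps)
    qed simp
    then have "std_normal_density h * indicator {..<- L} h \<le> std_normal_density h * (1 / L\<^sup>2 * h\<^sup>2)"
      by (rule mult_left_mono) simp
    then show "std_normal_density h * indicator {..<- L} h \<le> 1 / L\<^sup>2 * (std_normal_density h * h ^ 2)"
      by (simp add: mult_ac)
  qed simp
  also have "\<dots> = 1 / L\<^sup>2"
    using integral_std_normal_moment_even[of 1] by simp
  finally show ?thesis .
qed

lemma gauss_avg_ge:
  assumes u: "tail_fun u" and L: "L > 0" and p: "p \<le> 1" and ge: "\<And>y. y \<le> x + L \<Longrightarrow> p \<le> u y"
  shows "p - 1 / L\<^sup>2 \<le> gauss_avg u x"
proof (cases "p \<ge> 0")
  case False
  have "0 \<le> gauss_avg u x" using tail_fun_avg(1)[OF u, of x 1] by (simp add: gauss_avg_def)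
  moreover have "0 \<le> 1 / L\<^sup>2" by simp
  ultimately show ?thesis using False by linarith
next
  case True
  have i1: "integrable lborel (\<lambda>h. std_normal_density h * indicator {..<- L} h)"
    by (rule integrable_gauss_bounded[where B = 1]) (auto split: split_indicator)
  have "p - 1 / L\<^sup>2 \<le> p - p * (\<integral>h. std_normal_density h * indicator {..<- L} h \<partial>lborel)"
  proof -
    have "p * (\<integral>h. std_normal_density h * indicator {..<- L} h \<partial>lborel) \<le> 1 * (1 / L\<^sup>2)"
      using True p gauss_left_tail[OF L] by (intro mult_mono) auto
    then show ?thesis by simp
  qed
  also have "\<dots> = (\<integral>h. p * std_normal_density h - p * (std_normal_density h * indicator {..<- L} h) \<partial>lborel)"
    using i1 by simp
  also have "\<dots> \<le> (\<integral>h. std_normal_density h * u (x - 1 * h) \<partial>lborel)"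
  proof (rule integral_mono)
    fix h
    have "p - p * indicator {..<- L} h \<le> u (x - 1 * h)"
      using ge[of "x - h"] tail_funD[OF u] by (auto split: split_indicator)
    then have "std_normal_density h * (p - p * indicator {..<- L} h) \<le> std_normal_density h * u (x - 1 * h)"
      by (rule mult_left_mono) simp
    then show "p * std_normal_density h - p * (std_normal_density h * indicator {..<- L} h) \<le> std_normal_density h * u (x - 1 * h)"
      by (simp add: algebra_simps)
  qed (use i1 tail_fun_integrable[OF u, of x 1] in auto)
  finally show ?thesis by (simp add: gauss_avg_def)
qed

text \<open>After \<open>r\<close> generations there are \<open>2 ^ r\<close> independent attempts, all started from a bounded region.\<close>

lemma amplify:
  assumes "\<eta> > 0"
  shows "\<exists>K. \<forall>u X \<delta>. tail_fun u \<longrightarrow> 0 \<le> \<delta> \<longrightarrow> \<delta> \<le> 1 \<longrightarrow> (\<forall>x\<le>X. \<delta> \<le> u x) \<longrightarrow>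
    (\<forall>x\<le>X - K. 1 - (1 - \<delta>) ^ (2 ^ r) - \<eta> \<le> (branch 1 ^^ r) u x)"
  using assms
proof (induction r arbitrary: \<eta>)
  case 0
  then show ?case by (intro exI[of _ 0]) force
next
  case (Suc r)
  have "\<eta> / 4 > 0" using Suc.prems by simp
  from Suc.IH[OF this] obtain K where K0: "\<forall>u X \<delta>. tail_fun u \<longrightarrow> 0 \<le> \<delta> \<longrightarrow> \<delta> \<le> 1 \<longrightarrow> (\<forall>x\<le>X. \<delta> \<le> u x) \<longrightarrow>
    (\<forall>x\<le>X - K. 1 - (1 - \<delta>) ^ (2 ^ r) - \<eta> / 4 \<le> (branch 1 ^^ r) u x)" ..
  have K: "1 - (1 - \<delta>) ^ (2 ^ r) - \<eta> / 4 \<le> (branch 1 ^^ r) u x"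
    if "tail_fun u" "0 \<le> \<delta>" "\<delta> \<le> 1" "\<forall>x\<le>X. \<delta> \<le> u x" "x \<le> X - K" for u X \<delta> x
    using K0 that by blast
  \<comment> \<open>Makes the Chebyshev error \<open>\<eta> / 4\<close>. With the error from the
    induction hypothesis this gives \<open>\<eta> / 2\<close>, and squaring at most doubles
    it.\<close>
  define L where "L = 2 / sqrt \<eta>"
  have L: "L > 0" "1 / L\<^sup>2 = \<eta> / 4" using Suc.prems by (auto simp: L_def power_divide)
  show ?case
  proof (intro exI[of _ "K + L"] allI impI)
    fix u X \<delta> x
    assume u: "tail_fun u" and d: "0 \<le> \<delta>" "\<delta> \<le> 1" and ge: "\<forall>x\<le>X. \<delta> \<le> u x" and x: "x \<le> X - (K + L)"
    define a where "a = (1 - \<delta>) ^ (2 ^ r)"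
    have a: "0 \<le> a" "a \<le> 1" using d by (auto simp: a_def power_le_one)
    define v where "v = (branch 1 ^^ r) u"
    have v: "tail_fun v" unfolding v_def by (rule tail_fun_funpow[OF u])
    define g where "g = gauss_avg v x"
    have g: "0 \<le> g" "g \<le> 1" using tail_fun_avg[OF v, of x 1] by (simp_all add: g_def gauss_avg_def)
    have "(1 - a - \<eta> / 4) - 1 / L\<^sup>2 \<le> g" unfolding g_def
    proof (rule gauss_avg_ge[OF v L(1)])
      show "1 - a - \<eta> / 4 \<le> 1" using a Suc.prems by simp
      show "1 - a - \<eta> / 4 \<le> v y" if "y \<le> x + L" for y
        unfolding a_def v_def using that x by (intro K[OF u d ge]) auto
    qed
    then have "1 - g \<le> a + \<eta> / 2" unfolding L(2) by simp
    have "(1 - g)\<^sup>2 \<le> a\<^sup>2 + \<eta>"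
    proof (cases "1 - g \<le> a")
      case True
      then have "(1 - g)\<^sup>2 \<le> a\<^sup>2" using g by (intro power_mono) auto
      then show ?thesis using Suc.prems by simp
    next
      case False
      have "(1 - g - a) * (1 - g + a) \<le> \<eta> / 2 * 2"
        using False a g \<open>1 - g \<le> a + \<eta> / 2\<close> Suc.prems by (intro mult_mono) auto
      then show ?thesis by (simp add: power2_eq_square algebra_simps)
    qed
    moreover have "a\<^sup>2 = (1 - \<delta>) ^ (2 ^ Suc r)" by (simp add: a_def power_mult[symmetric] mult.commute)
    ultimately show "1 - (1 - \<delta>) ^ 2 ^ Suc r - \<eta> \<le> (branch 1 ^^ Suc r) u x"
      by (simp add: branch_1 g_def v_def)
  qed
qed

text \<open>A translation of the argument is a translation of the initial data, and the recursion is
  monotone in these.\<close>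

lemma hom_tail_antimono:
  assumes "x \<le> y"
  shows "hom_tail m y \<le> hom_tail m x"
proof -
  have "hom_tail m y = (branch 1 ^^ m) (\<lambda>z. neg_ind (z + (y - x))) x"
    unfolding branch_funpow_shift by simp
  also have "\<dots> \<le> hom_tail m x"
    using assms tail_fun_scale[OF tail_fun_neg_ind, of 1 "y - x"]
    by (intro branch_funpow_mono tail_fun_neg_ind) (auto simp: neg_ind_def)
  finally show ?thesis .
qed

text \<open>The first \<open>r\<close> generations turn a success probability
  \<open>\<delta>\<close> into one near \<open>1\<close>. As \<open>r\<close> depends only on
  \<open>\<epsilon>\<close>, this costs a bounded displacement.\<close>

lemma hom_tail_tight:
  assumes e: "\<epsilon> > 0"
  obtains K where "\<And>n. 1 - \<epsilon> \<le> hom_tail n (mean_pos n - K)"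
proof -
  obtain \<delta> where d: "0 < \<delta>" "\<delta> \<le> 1" "\<And>n. n \<ge> 1 \<Longrightarrow> \<delta> \<le> hom_tail n (mean_pos n + 1)"
    using hom_tail_lower by blast
  have "(\<lambda>r. (1 - \<delta>) ^ r) \<longlonglongrightarrow> 0" using d by (intro LIMSEQ_power_zero) auto
  then have "eventually (\<lambda>r. (1 - \<delta>) ^ r < \<epsilon> / 2) sequentially"
    using e by (intro order_tendstoD) auto
  then obtain r where r0: "(1 - \<delta>) ^ r < \<epsilon> / 2"
    using eventually_happens'[OF sequentially_bot] by blast
  have "(1 - \<delta>) ^ (2 ^ r) \<le> (1 - \<delta>) ^ r"
    using d by (intro power_decreasing) (auto intro: less_imp_le)
  with r0 have r: "(1 - \<delta>) ^ (2 ^ r) \<le> \<epsilon> / 2" by linarith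
  obtain Kf where Kf: "\<And>r u X \<delta> x. tail_fun u \<Longrightarrow> 0 \<le> \<delta> \<Longrightarrow> \<delta> \<le> 1 \<Longrightarrow> (\<forall>x\<le>X. \<delta> \<le> u x) \<Longrightarrow> x \<le> X - Kf r
      \<Longrightarrow> 1 - (1 - \<delta>) ^ (2 ^ r) - \<epsilon> / 2 \<le> (branch 1 ^^ r) u x"
    using amplify[of "\<epsilon> / 2"] e by (metis (no_types, lifting) half_gt_zero)
  \<comment> \<open>Summing over all \<open>j \<le> r\<close> also covers walks with at most
    \<open>r\<close> generations, to which the amplification is applied with
    \<open>\<delta> = 1\<close> and \<open>neg_ind\<close> itself.\<close>
  define K where "K = crit * real r + (\<Sum>j\<le>r. \<bar>Kf j\<bar>) + 1"
  have Kj: "Kf j \<le> (\<Sum>j\<le>r. \<bar>Kf j\<bar>)" if "j \<le> r" for j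
    using member_le_sum[of j "{..r}" "\<lambda>j. \<bar>Kf j\<bar>"] that by simp
  show thesis
  proof (rule that[of K])
    fix n
    show "1 - \<epsilon> \<le> hom_tail n (mean_pos n - K)"
    proof (cases "n \<le> r")
      case True
      have "mean_pos n \<le> crit * real r"
      proof -
        \<comment> \<open>For \<open>n = 0\<close> this relies on the value
          \<open>ln 0 = 0\<close>.\<close>
        have "0 \<le> 3 / (2 * crit) * ln (real n)" using crit_pos by (cases n) auto
        moreover have "crit * real n \<le> crit * real r" using True crit_pos by simp
        ultimately show ?thesis by (simp add: mean_pos_def)
      qed
      then have "mean_pos n - K \<le> - 1 - Kf n" using Kj[OF True] by (simp add: K_def)
      from Kf[OF tail_fun_neg_ind _ _ _ this, of 1] have "1 - \<epsilon> / 2 \<le> hom_tail n (mean_pos n - K)"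
        by (simp add: neg_ind_def power_0_left)
      then show ?thesis using e by simp
    next
      case False
      have "mean_pos n \<le> mean_pos (n - r) + crit * real r"
      proof -
        have "ln (real (n - r)) \<le> ln (real n)" using False by (subst ln_le_cancel_iff) auto
        then have "3 / (2 * crit) * ln (real (n - r)) \<le> 3 / (2 * crit) * ln (real n)"
          using crit_pos by (intro mult_left_mono) auto
        then show ?thesis using False by (simp add: mean_pos_def of_nat_diff algebra_simps)
      qed
      then have x: "mean_pos n - K \<le> mean_pos (n - r) + 1 - Kf r" using Kj[of r] by (simp add: K_def)
      have "1 - (1 - \<delta>) ^ (2 ^ r) - \<epsilon> / 2 \<le> (branch 1 ^^ r) (hom_tail (n - r)) (mean_pos n - K)"
      proof (rule Kf[OF _ _ _ _ x])
        show "tail_fun (hom_tail (n - r))" by (intro tail_fun_funpow tail_fun_neg_ind)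
        show "\<forall>x\<le>mean_pos (n - r) + 1. \<delta> \<le> hom_tail (n - r) x"
          using d(3)[of "n - r"] hom_tail_antimono[of _ "mean_pos (n - r) + 1" "n - r"] False by force
      qed (use d in auto)
      also have "(branch 1 ^^ r) (hom_tail (n - r)) = hom_tail n"
        using False by (metis comp_apply funpow_add le_add_diff_inverse nat_le_linear)
      finally show ?thesis using r by simp
    qed
  qed
qed

text \<open>The map \<open>p \<mapsto> 1 - (1 - p)\<^sup>2\<close> is concave on the unit interval
  and vanishes at \<open>0\<close>. This carries the success probability of the second half through
  the first half.\<close>

lemma branch_scale_le:
  assumes u: "tail_fun u" and c: "0 \<le> c" "c \<le> 1"
  shows "c * branch \<sigma> u x \<le> branch \<sigma> (\<lambda>x. c * u x) x"
proof -
  define p where "p = (\<integral>y. std_normal_density y * u (x - \<sigma> * y) \<partial>lborel)"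
  have "(\<integral>y. std_normal_density y * (c * u (x - \<sigma> * y)) \<partial>lborel) = c * p"
    unfolding p_def by (simp add: mult.left_commute flip: integral_mult_right_zero)
  then have "branch \<sigma> (\<lambda>x. c * u x) x = 1 - (1 - c * p)\<^sup>2" by (simp add: branch_def)
  moreover have "c * (c * p\<^sup>2) \<le> c * (1 * p\<^sup>2)" using c by (intro mult_left_mono mult_right_mono) auto
  then have "c * (1 - (1 - p)\<^sup>2) \<le> 1 - (1 - c * p)\<^sup>2" by (simp add: power2_eq_square algebra_simps)
  ultimately show ?thesis by (simp add: branch_def p_def)
qed

lemma tail_fun_mult: "tail_fun u \<Longrightarrow> 0 \<le> c \<Longrightarrow> c \<le> 1 \<Longrightarrow> tail_fun (\<lambda>x. c * u x)"
  unfolding tail_fun_def by (auto intro: mult_le_one)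

lemma branch_funpow_scale_le:
  assumes u: "tail_fun u" and c: "0 \<le> c" "c \<le> 1"
  shows "c * (branch \<sigma> ^^ k) u x \<le> (branch \<sigma> ^^ k) (\<lambda>x. c * u x) x"
proof (induction k arbitrary: x)
  case (Suc k)
  have "c * branch \<sigma> ((branch \<sigma> ^^ k) u) x \<le> branch \<sigma> (\<lambda>x. c * (branch \<sigma> ^^ k) u x) x"
    by (intro branch_scale_le tail_fun_funpow u c)
  also have "\<dots> \<le> branch \<sigma> ((branch \<sigma> ^^ k) (\<lambda>x. c * u x)) x"
    by (intro branch_mono tail_fun_mult tail_fun_funpow u c Suc)
  finally show ?case by simp
qed simp

lemma two_speed_lower:
  fixes \<sigma>\<^sub>1 \<sigma>\<^sub>2 :: real
  assumes s: "0 < \<sigma>\<^sub>1" "0 < \<sigma>\<^sub>2" and e: "0 < \<epsilon>" "\<epsilon> \<le> 1"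
  obtains K :: real where "\<And>(m\<^sub>1::nat) (m\<^sub>2::nat).
    1 - \<epsilon> \<le> (branch \<sigma>\<^sub>1 ^^ m\<^sub>1) ((branch \<sigma>\<^sub>2 ^^ m\<^sub>2) neg_ind) (\<sigma>\<^sub>2 * mean_pos m\<^sub>2 + \<sigma>\<^sub>1 * mean_pos m\<^sub>1 - K)"
proof -
  obtain K where K: "\<And>n. 1 - \<epsilon> / 2 \<le> hom_tail n (mean_pos n - K)"
    using hom_tail_tight[of "\<epsilon> / 2"] e by auto
  show thesis
  proof (rule that)
    fix m\<^sub>1 m\<^sub>2 :: nat
    define Y where "Y = \<sigma>\<^sub>2 * (mean_pos m\<^sub>2 - K)"
    define c where "c = 1 - \<epsilon> / 2"
    have c: "0 \<le> c" "c \<le> 1" using e by (auto simp: c_def)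
    have shift: "tail_fun (\<lambda>x. neg_ind (x + - Y))"
      using tail_fun_scale[OF tail_fun_neg_ind, of 1 "- Y"] by simp
    \<comment> \<open>The tail of the second half lies above \<open>c\<close> times a step function,
      which is a translate of the initial data of a homogeneous walk. The first half then succeeds
      with probability at least \<open>c\<close> as well, and
      \<open>c * c \<ge> 1 - \<epsilon>\<close>.\<close>
    have V: "c * neg_ind (x + - Y) \<le> (branch \<sigma>\<^sub>2 ^^ m\<^sub>2) neg_ind x" for x
    proof (cases "x < Y")
      case True
      have "c \<le> hom_tail m\<^sub>2 (mean_pos m\<^sub>2 - K)" unfolding c_def by (rule K)
      also have "\<dots> \<le> hom_tail m\<^sub>2 (x / \<sigma>\<^sub>2)"
        using True s by (intro hom_tail_antimono) (simp add: Y_def field_simps)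
      also have "\<dots> = (branch \<sigma>\<^sub>2 ^^ m\<^sub>2) neg_ind x"
        using branch_funpow_neg_ind[OF s(2), of m\<^sub>2 "x / \<sigma>\<^sub>2"] s by simp
      finally show ?thesis using True by (simp add: neg_ind_def)
    next
      case False
      then show ?thesis using tail_funD[OF tail_fun_funpow[OF tail_fun_neg_ind]] by (simp add: neg_ind_def)
    qed
    let ?x = "\<sigma>\<^sub>2 * mean_pos m\<^sub>2 + \<sigma>\<^sub>1 * mean_pos m\<^sub>1 - (\<sigma>\<^sub>2 * K + \<sigma>\<^sub>1 * K)"
    have "1 - \<epsilon> \<le> c * c" by (simp add: c_def algebra_simps)
    also have "\<dots> \<le> c * hom_tail m\<^sub>1 (mean_pos m\<^sub>1 - K)" using K[of m\<^sub>1] c by (intro mult_left_mono) (simp_all add: c_def)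
    also have "hom_tail m\<^sub>1 (mean_pos m\<^sub>1 - K) = (branch \<sigma>\<^sub>1 ^^ m\<^sub>1) neg_ind (?x + - Y)"
      unfolding branch_funpow_neg_ind[OF s(1), symmetric] Y_def by (simp add: algebra_simps)
    also have "\<dots> = (branch \<sigma>\<^sub>1 ^^ m\<^sub>1) (\<lambda>x. neg_ind (x + - Y)) ?x"
      by (rule branch_funpow_shift[symmetric])
    also have "c * \<dots> \<le> (branch \<sigma>\<^sub>1 ^^ m\<^sub>1) (\<lambda>x. c * neg_ind (x + - Y)) ?x"
      by (rule branch_funpow_scale_le[OF shift c])
    also have "\<dots> \<le> (branch \<sigma>\<^sub>1 ^^ m\<^sub>1) ((branch \<sigma>\<^sub>2 ^^ m\<^sub>2) neg_ind) ?x"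
      by (intro branch_funpow_mono tail_fun_mult shift c tail_fun_funpow tail_fun_neg_ind V)
    finally show "1 - \<epsilon> \<le> (branch \<sigma>\<^sub>1 ^^ m\<^sub>1) ((branch \<sigma>\<^sub>2 ^^ m\<^sub>2) neg_ind) ?x" .
  qed
qed

subsection \<open>The law of the maximum\<close>

text \<open>The maximum over the descendants of \<open>v\<close> after \<open>k\<close> generations,
  relative to \<open>v\<close>. It is written as a function of the increments alone, so disjoint
  edge sets yield independence.\<close>

fun sub_max :: "nat \<Rightarrow> bool list \<Rightarrow> (bool list \<times> bool \<Rightarrow> real) \<Rightarrow> real" where
  "sub_max 0 v d = 0"
| "sub_max (Suc k) v d = max (d (v, False) + sub_max k (v @ [False]) d) (d (v, True) + sub_max k (v @ [True]) d)"

definition sub_edges :: "nat \<Rightarrow> bool list \<Rightarrow> (bool list \<times> bool) set" where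
  "sub_edges k v = {(v @ w, i) | w i. length w < k}"

lemma sub_edges_Suc: "sub_edges k (v @ [i]) \<subseteq> sub_edges (Suc k) v" "(v, i) \<in> sub_edges (Suc k) v"
  by (auto simp: sub_edges_def)

lemma sub_max_cong:
  "(\<And>e. e \<in> sub_edges k v \<Longrightarrow> d e = d' e) \<Longrightarrow> sub_max k v d = sub_max k v d'"
proof (induction k arbitrary: v)
  case (Suc k)
  have "sub_max k (v @ [i]) d = sub_max k (v @ [i]) d'" for i
    using sub_edges_Suc(1)[of k v i] by (intro Suc.IH Suc.prems) auto
  moreover have "d (v, i) = d' (v, i)" for i by (intro Suc.prems sub_edges_Suc)
  ultimately show ?case by simp
qed simp

lemma sub_max_measurable:
  "sub_edges k v \<subseteq> E \<Longrightarrow> sub_max k v \<in> borel_measurable (PiM E (\<lambda>_. borel))"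
proof (induction k arbitrary: v)
  case 0
  have "sub_max 0 v = (\<lambda>_. 0)" by (simp add: fun_eq_iff)
  then show ?case by simp
next
  case (Suc k)
  have [measurable]: "(v, i) \<in> E" for i using Suc.prems sub_edges_Suc(2)[of v i k] by auto
  have [measurable]: "sub_max k (v @ [i]) \<in> borel_measurable (PiM E (\<lambda>_. borel))" for i
    using Suc.prems sub_edges_Suc(1)[of k v i] by (intro Suc.IH) auto
  have "sub_max (Suc k) v = (\<lambda>d. max (d (v, False) + sub_max k (v @ [False]) d) (d (v, True) + sub_max k (v @ [True]) d))"
    by (simp add: fun_eq_iff)
  also have "\<dots> \<in> borel_measurable (PiM E (\<lambda>_. borel))" by measurable
  finally show ?case .
qed

lemma sub_max_eq_Max:
  "sub_max k v (\<lambda>e. displacement S e \<omega>) = (MAX w\<in>{w. length w = k}. S (v @ w) \<omega>) - S v \<omega>"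
proof (induction k arbitrary: v)
  case (Suc k)
  have fin: "finite {w :: bool list. length w = k}" "{w :: bool list. length w = k} \<noteq> {}"
    using finite_lists_length_eq[of "UNIV :: bool set" k] by (auto intro: exI[of _ "replicate k True"])
  let ?A = "\<lambda>i. (\<lambda>w. S (v @ [i] @ w) \<omega>) ` {w. length w = k}"
  have split: "(\<lambda>w. S (v @ w) \<omega>) ` {w. length w = Suc k} = ?A False \<union> ?A True"
  proof -
    have "{w :: bool list. length w = Suc k} = (\<Union>i. (\<lambda>w. [i] @ w) ` {w. length w = k})"
      by (auto simp: length_Suc_conv)
    then show ?thesis by (simp add: image_Un image_image UNIV_bool Un_commute)
  qed
  have "Max (?A False \<union> ?A True) = max (Max (?A False)) (Max (?A True))"
    using fin by (intro Max_Un) auto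
  moreover have "displacement S (v, i) \<omega> + sub_max k (v @ [i]) (\<lambda>e. displacement S e \<omega>) = Max (?A i) - S v \<omega>" for i
    unfolding Suc.IH by (simp add: displacement_def)
  ultimately show ?case unfolding sub_max.simps split by (simp add: max_def)
qed simp

context two_variance_brw
begin

abbreviation disp :: "'a \<Rightarrow> bool list \<times> bool \<Rightarrow> real" where "disp \<omega> \<equiv> \<lambda>e. displacement S e \<omega>"

lemma sub_edges_le: "length v + k \<le> n \<Longrightarrow> sub_edges k v \<subseteq> {(v, i). length v < n}"
  by (auto simp: sub_edges_def)

lemma displacement_measurable: "length v < n \<Longrightarrow> displacement S (v, i) \<in> borel_measurable M"
  using distributed_measurable[OF normal_steps[of v i]] by simp

lemma sub_max_restrict: "sub_edges k v \<subseteq> E \<Longrightarrow> sub_max k v (restrict d E) = sub_max k v d"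
  by (intro sub_max_cong) auto

lemma sub_max_rv:
  assumes "length v + k \<le> n"
  shows "(\<lambda>\<omega>. sub_max k v (disp \<omega>)) \<in> borel_measurable M"
proof -
  let ?E = "sub_edges k v"
  have "(\<lambda>\<omega>. restrict (disp \<omega>) ?E) \<in> measurable M (PiM ?E (\<lambda>_. borel))"
    using sub_edges_le[OF assms] by (intro measurable_restrict) (auto intro: displacement_measurable)
  from measurable_compose[OF this sub_max_measurable[OF order_refl]]
  show ?thesis by (simp add: sub_max_restrict)
qed

lemma indep_steps_parts:
  assumes "A \<inter> B = {}" "A \<subseteq> {(v, i). length v < n}" "B \<subseteq> {(v, i). length v < n}"
    and f: "f \<in> borel_measurable (PiM A (\<lambda>_. borel))" and g: "g \<in> borel_measurable (PiM B (\<lambda>_. borel))"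
  shows "indep_var borel (\<lambda>\<omega>. f (restrict (disp \<omega>) A) :: real) borel (\<lambda>\<omega>. g (restrict (disp \<omega>) B) :: real)"
  using indep_var_compose[OF indep_var_restrict[OF indep_steps assms(1-3)] f g] by (simp add: comp_def)

text \<open>The displacement of a child is independent of everything in the subtree below it, so
  Fubini gives a convolution; the substitution \<open>a = \<sigma> * y\<close> with the current
  standard deviation normalizes the kernel.\<close>

lemma prob_branch_le:
  assumes v: "length v + Suc k = n" and s: "step_sd n \<sigma>\<^sub>1 \<sigma>\<^sub>2 (length v) > 0"
  shows "prob {\<omega> \<in> space M. displacement S (v, i) \<omega> + sub_max k (v @ [i]) (disp \<omega>) \<le> x}
    = (\<integral>y. std_normal_density y * prob {\<omega> \<in> space M. sub_max k (v @ [i]) (disp \<omega>) \<le> x - step_sd n \<sigma>\<^sub>1 \<sigma>\<^sub>2 (length v) * y} \<partial>lborel)"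
proof -
  let ?\<sigma> = "step_sd n \<sigma>\<^sub>1 \<sigma>\<^sub>2 (length v)"
  define D where "D = displacement S (v, i)"
  define Y where "Y \<omega> = sub_max k (v @ [i]) (disp \<omega>)" for \<omega>
  have [measurable]: "D \<in> borel_measurable M" unfolding D_def using v by (intro displacement_measurable) simp
  have [measurable]: "Y \<in> borel_measurable M" unfolding Y_def using v by (intro sub_max_rv) simp
  have ind: "indep_var borel D borel Y"
  proof -
    have "indep_var borel (\<lambda>\<omega>. (restrict (disp \<omega>) {(v, i)}) (v, i)) borel
      (\<lambda>\<omega>. sub_max k (v @ [i]) (restrict (disp \<omega>) (sub_edges k (v @ [i]))))"
      using v sub_edges_le[of "v @ [i]" k]
      by (intro indep_steps_parts sub_max_measurable) (auto simp: sub_edges_def)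
    then show ?thesis by (simp add: sub_max_restrict D_def Y_def[abs_def])
  qed
  define F where "F x = prob {\<omega> \<in> space M. Y \<omega> \<le> x}" for x
  have FI: "F x = (\<integral>y. indicator {..x} y \<partial>distr M borel Y)" for x
    by (simp add: F_def measure_distr vimage_def Int_def conj_commute)
  have F_mono: "mono F"
    unfolding F_def by (intro monoI finite_measure_mono) auto
  then have [measurable]: "F \<in> borel_measurable borel" by (rule borel_measurable_mono)
  interpret Y: prob_space "distr M borel Y" by (rule prob_space_distr) simp
  interpret DD: prob_space "distr M borel D" by (rule prob_space_distr) simp
  interpret P: pair_sigma_finite "distr M borel D" "distr M borel Y" ..
  interpret PP: pair_prob_space "distr M borel D" "distr M borel Y" ..
  have "prob {\<omega> \<in> space M. D \<omega> + Y \<omega> \<le> x} = (\<integral>\<omega>. indicat_real {p. fst p + snd p \<le> x} (D \<omega>, Y \<omega>) \<partial>M)"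
  proof -
    have "{\<omega> \<in> space M. D \<omega> + Y \<omega> \<le> x} \<in> sets M" by measurable
    then have "prob {\<omega> \<in> space M. D \<omega> + Y \<omega> \<le> x} = (\<integral>\<omega>. indicator {\<omega> \<in> space M. D \<omega> + Y \<omega> \<le> x} \<omega> \<partial>M)"
      by simp
    also have "\<dots> = (\<integral>\<omega>. indicat_real {p. fst p + snd p \<le> x} (D \<omega>, Y \<omega>) \<partial>M)"
      by (intro Bochner_Integration.integral_cong) (auto split: split_indicator)
    finally show ?thesis .
  qed
  also have "\<dots> = (\<integral>p. indicat_real {p. fst p + snd p \<le> x} p \<partial>distr M (borel \<Otimes>\<^sub>M borel) (\<lambda>\<omega>. (D \<omega>, Y \<omega>)))"
    by (subst integral_distr) auto
  also have "distr M (borel \<Otimes>\<^sub>M borel) (\<lambda>\<omega>. (D \<omega>, Y \<omega>)) = distr M borel D \<Otimes>\<^sub>M distr M borel Y"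
    using ind unfolding indep_var_distribution_eq by simp
  also have "(\<integral>p. indicat_real {p. fst p + snd p \<le> x} p \<partial>(distr M borel D \<Otimes>\<^sub>M distr M borel Y))
    = (\<integral>a. \<integral>b. indicat_real {p. fst p + snd p \<le> x} (a, b) \<partial>distr M borel Y \<partial>distr M borel D)"
  proof -
    have "integrable (distr M borel D \<Otimes>\<^sub>M distr M borel Y) (indicat_real {p. fst p + snd p \<le> x})"
      by (rule PP.integrable_const_bound[where B = 1]) (auto split: split_indicator)
    then show ?thesis by (rule P.integral_fst'[symmetric])
  qed
  also have "\<dots> = (\<integral>a. F (x - a) \<partial>distr M borel D)"
    unfolding FI by (intro Bochner_Integration.integral_cong) (auto simp: algebra_simps split: split_indicator)
  also have "\<dots> = (\<integral>\<omega>. F (x - D \<omega>) \<partial>M)"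
    by (subst integral_distr) auto
  also have "\<dots> = (\<integral>a. normal_density 0 ?\<sigma> a * F (x - a) \<partial>lborel)"
    using normal_steps[of v i] v unfolding D_def by (intro distributed_integral[symmetric]) auto
  also have "\<dots> = (\<integral>y. std_normal_density y * F (x - ?\<sigma> * y) \<partial>lborel)"
  proof -
    have "(\<integral>a. normal_density 0 ?\<sigma> a * F (x - a) \<partial>lborel) = \<bar>?\<sigma>\<bar> *\<^sub>R (\<integral>y. normal_density 0 ?\<sigma> (0 + ?\<sigma> * y) * F (x - (0 + ?\<sigma> * y)) \<partial>lborel)"
      using s by (intro lborel_integral_real_affine) simp
    also have "\<dots> = (\<integral>y. ?\<sigma> * (normal_density 0 ?\<sigma> (?\<sigma> * y) * F (x - ?\<sigma> * y)) \<partial>lborel)"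
      using s by simp
    also have "\<dots> = (\<integral>y. std_normal_density y * F (x - ?\<sigma> * y) \<partial>lborel)"
      using s by (intro Bochner_Integration.integral_cong refl)
        (simp add: normal_density_def real_sqrt_mult power_mult_distrib)
    finally show ?thesis .
  qed
  finally show ?thesis by (simp add: D_def Y_def F_def)
qed

text \<open>The two children use disjoint sets of edges, so the events that both stay below
  \<open>x\<close> are independent.\<close>

lemma prob_sub_max_Suc:
  assumes v: "length v + Suc k = n"
  shows "prob {\<omega> \<in> space M. sub_max (Suc k) v (disp \<omega>) \<le> x}
    = (\<Prod>i\<in>UNIV. prob {\<omega> \<in> space M. displacement S (v, i) \<omega> + sub_max k (v @ [i]) (disp \<omega>) \<le> x})"
proof -
  define Z where "Z i \<omega> = displacement S (v, i) \<omega> + sub_max k (v @ [i]) (disp \<omega>)" for i \<omega>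
  define A where "A i = insert (v, i) (sub_edges k (v @ [i]))" for i
  have A: "A i \<subseteq> {(v, i). length v < n}" for i
    using v sub_edges_le[of "v @ [i]" k] by (auto simp: A_def)
  define f where "f i d = d (v, i) + sub_max k (v @ [i]) d" for i and d :: "bool list \<times> bool \<Rightarrow> real"
  have f: "f i \<in> borel_measurable (PiM (A i) (\<lambda>_. borel))" for i
    unfolding f_def by (intro borel_measurable_add sub_max_measurable measurable_component_singleton) (auto simp: A_def)
  have "indep_var borel (\<lambda>\<omega>. f False (restrict (disp \<omega>) (A False))) borel (\<lambda>\<omega>. f True (restrict (disp \<omega>) (A True)))"
    by (intro indep_steps_parts f A) (auto simp: A_def sub_edges_def)
  moreover have "f i (restrict (disp \<omega>) (A i)) = Z i \<omega>" for i \<omega>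
    unfolding f_def Z_def by (subst sub_max_restrict) (auto simp: A_def)
  ultimately have "indep_var borel (Z False) borel (Z True)" by (simp add: Z_def[abs_def])
  from indep_varD[OF this, of "{..x}" "{..x}"]
  have "prob {\<omega> \<in> space M. Z False \<omega> \<le> x \<and> Z True \<omega> \<le> x} = prob {\<omega> \<in> space M. Z False \<omega> \<le> x} * prob {\<omega> \<in> space M. Z True \<omega> \<le> x}"
    by (simp add: vimage_def Int_def conj_ac)
  then show ?thesis by (simp add: Z_def UNIV_bool)
qed

text \<open>The induction goes from the leaves to the root, so the earliest generation is the
  outermost operator; hence \<open>foldr\<close>.\<close>

lemma prob_sub_max:
  assumes s: "\<sigma>\<^sub>1 > 0" "\<sigma>\<^sub>2 > 0"
  shows "length v + k = n \<Longrightarrow> prob {\<omega> \<in> space M. sub_max k v (disp \<omega>) \<le> x}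
    = 1 - foldr (\<lambda>j. branch (step_sd n \<sigma>\<^sub>1 \<sigma>\<^sub>2 j)) [n - k..<n] neg_ind x"
proof (induction k arbitrary: v x)
  case 0
  then show ?case by (simp add: neg_ind_def prob_space)
next
  case (Suc k)
  define j where "j = n - Suc k"
  have j: "length v = j" "Suc j = n - k" "j < n" using Suc.prems by (auto simp: j_def)
  define \<sigma> where "\<sigma> = step_sd n \<sigma>\<^sub>1 \<sigma>\<^sub>2 j"
  have \<sigma>: "\<sigma> > 0" using s by (simp add: \<sigma>_def step_sd_def)
  define u where "u = foldr (\<lambda>j. branch (step_sd n \<sigma>\<^sub>1 \<sigma>\<^sub>2 j)) [n - k..<n] neg_ind"
  have foldr_tf: "tail_fun (foldr (\<lambda>j. branch (step_sd n \<sigma>\<^sub>1 \<sigma>\<^sub>2 j)) xs neg_ind)" for xs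
    by (induction xs) (auto intro: tail_fun_branch tail_fun_neg_ind)
  have u: "tail_fun u" unfolding u_def by (rule foldr_tf)
  have IH: "prob {\<omega> \<in> space M. sub_max k (v @ [i]) (disp \<omega>) \<le> x} = 1 - u x" for i x
    using Suc.IH[of "v @ [i]" x] Suc.prems by (simp add: u_def)
  have "prob {\<omega> \<in> space M. displacement S (v, i) \<omega> + sub_max k (v @ [i]) (disp \<omega>) \<le> x}
    = 1 - (\<integral>y. std_normal_density y * u (x - \<sigma> * y) \<partial>lborel)" for i
    using prob_branch_le[OF Suc.prems, of i x] \<sigma> tail_fun_integrable[OF u, of x \<sigma>]
    unfolding IH j(1) \<sigma>_def[symmetric] by (simp add: right_diff_distrib)
  then have "prob {\<omega> \<in> space M. sub_max (Suc k) v (disp \<omega>) \<le> x} = 1 - branch \<sigma> u x"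
    unfolding prob_sub_max_Suc[OF Suc.prems] by (simp add: branch_def UNIV_bool power2_eq_square)
  moreover have "[n - Suc k..<n] = j # [n - k..<n]" using j by (simp add: upt_conv_Cons j_def)
  ultimately show ?case by (simp add: u_def \<sigma>_def)
qed

lemma max_displacement_eq:
  assumes "\<omega> \<in> space M"
  shows "max_displacement n S \<omega> = sub_max n [] (disp \<omega>)"
  unfolding sub_max_eq_Max using start[OF assms] by (simp add: max_displacement_def)

lemma max_displacement_measurable: "max_displacement n S \<in> borel_measurable M"
  using sub_max_rv[of "[]" n] by (simp add: max_displacement_eq cong: measurable_cong)

lemma prob_max_displacement:
  assumes s: "\<sigma>\<^sub>1 > 0" "\<sigma>\<^sub>2 > 0"
  shows "prob {\<omega> \<in> space M. max_displacement n S \<omega> \<le> x}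
    = 1 - (branch \<sigma>\<^sub>1 ^^ (n - n div 2)) ((branch \<sigma>\<^sub>2 ^^ (n div 2)) neg_ind) x"
proof -
  define h where "h = n - n div 2"
  have foldr_const: "foldr (\<lambda>j. branch (step_sd n \<sigma>\<^sub>1 \<sigma>\<^sub>2 j)) xs u = (branch \<sigma> ^^ length xs) u"
    if "\<And>j. j \<in> set xs \<Longrightarrow> step_sd n \<sigma>\<^sub>1 \<sigma>\<^sub>2 j = \<sigma>" for xs \<sigma> u
    using that by (induction xs) auto
  have "[0..<n] = [0..<h] @ [h..<n]" by (metis h_def diff_le_self le0 upt_add_eq_append le_add_diff_inverse)
  \<comment> \<open>For odd \<open>n\<close> the middle generation still moves with the first
    variance, so \<open>h\<close> is \<open>n / 2\<close> rounded up.\<close>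
  moreover have "real j < real n / 2 \<longleftrightarrow> j < h" for j
  proof -
    have "real j < real n / 2 \<longleftrightarrow> 2 * j < n" by linarith
    also have "\<dots> \<longleftrightarrow> j < h" unfolding h_def by presburger
    finally show ?thesis .
  qed
  ultimately have "foldr (\<lambda>j. branch (step_sd n \<sigma>\<^sub>1 \<sigma>\<^sub>2 j)) [0..<n] neg_ind
    = (branch \<sigma>\<^sub>1 ^^ length [0..<h]) ((branch \<sigma>\<^sub>2 ^^ length [h..<n]) neg_ind)"
    using foldr_const[of "[0..<h]" \<sigma>\<^sub>1] foldr_const[of "[h..<n]" \<sigma>\<^sub>2]
    by (simp add: step_sd_def)
  moreover have "n - h = n div 2" by (simp add: h_def)
  moreover have "{\<omega> \<in> space M. max_displacement n S \<omega> \<le> x} = {\<omega> \<in> space M. sub_max n [] (disp \<omega>) \<le> x}"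
    using max_displacement_eq by auto
  ultimately show ?thesis using prob_sub_max[OF s, of "[]" n x] by (simp add: h_def)
qed

end

section \<open>Centering and tightness of the maximum\<close>

lemma front_le:
  assumes n: "n \<ge> 1" and m: "real m \<le> (real n + 1) / 2" "real n / 2 \<le> real m + 1"
  shows "front m \<le> crit * real n / 2 - 3 / (2 * crit) * ln (real n) + (crit / 2 + 3 / (2 * crit) * ln 6)"
proof -
  \<comment> \<open>\<open>n / 2 \<le> m + 1\<close> gives \<open>n / 6 \<le> (m + 3) / 3\<close>;
    the \<open>3\<close> is the offset of the barrier.\<close>
  have "ln (real n / 6) \<le> ln ((real m + 3) / 3)" using n m by (subst ln_le_cancel_iff) auto
  then have "ln (real n) - ln 6 \<le> ln (real m + 3) - ln 3" using n by (simp add: ln_div)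
  then have "3 / (2 * crit) * (ln (real n) - ln 6) \<le> 3 / (2 * crit) * (ln (real m + 3) - ln 3)"
    using crit_pos by (intro mult_left_mono) auto
  moreover have "crit * real m \<le> crit * ((real n + 1) / 2)" using m crit_pos by (intro mult_left_mono) auto
  moreover have "front m = crit * real m - 3 / (2 * crit) * (ln (real m + 3) - ln 3)"
    by (simp add: front_def barrier_def right_diff_distrib)
  ultimately show ?thesis by (simp add: right_diff_distrib distrib_left add_divide_distrib)
qed

lemma mean_pos_ge:
  assumes n: "n \<ge> 1" and m: "m \<le> n" "real n \<le> 2 * real m + 1"
  shows "crit * real n / 2 - 3 / (2 * crit) * ln (real n) - crit / 2 \<le> mean_pos m"
proof -
  have "ln (real m) \<le> ln (real n)"
  \<comment> \<open>\<open>m = 0\<close> forces \<open>n = 1\<close>; the claim then rests on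
    \<open>ln 0 = 0\<close>.\<close>
  proof (cases "m = 0")
    case False
    then show ?thesis using m by (subst ln_le_cancel_iff) auto
  qed (use n in simp)
  then have "3 / (2 * crit) * ln (real m) \<le> 3 / (2 * crit) * ln (real n)"
    using crit_pos by (intro mult_left_mono) auto
  moreover have "crit * (real n / 2) \<le> crit * (real m + 1 / 2)" using m crit_pos by (intro mult_left_mono) auto
  ultimately show ?thesis by (simp add: mean_pos_def distrib_left)
qed

lemma max_displacement_tight:
  fixes \<sigma>\<^sub>1 \<sigma>\<^sub>2 :: real
    and M :: "nat \<Rightarrow> 'a measure"
    and S :: "nat \<Rightarrow> bool list \<Rightarrow> 'a \<Rightarrow> real"
  assumes s: "0 < \<sigma>\<^sub>2" "\<sigma>\<^sub>2 < \<sigma>\<^sub>1"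
    and brw: "\<And>n. n \<ge> 1 \<Longrightarrow> two_variance_brw (M n) n \<sigma>\<^sub>1 \<sigma>\<^sub>2 (S n)"
  defines "a n \<equiv> (\<sigma>\<^sub>1 + \<sigma>\<^sub>2) * (crit * real n / 2 - 3 / (2 * crit) * ln (real n))"
  shows "stochastically_bounded M (\<lambda>n \<omega>. max_displacement n (S n) \<omega> - a n)"
  unfolding stochastically_bounded_def
proof (intro conjI allI impI)
  fix n :: nat assume n: "n \<ge> 1"
  show "(\<lambda>\<omega>. max_displacement n (S n) \<omega> - a n) \<in> borel_measurable (M n)"
    using two_variance_brw.max_displacement_measurable[OF brw[OF n]] by simp
next
  fix \<epsilon> :: real assume e: "\<epsilon> > 0"
  define W where "W n = (branch \<sigma>\<^sub>1 ^^ (n - n div 2)) ((branch \<sigma>\<^sub>2 ^^ (n div 2)) neg_ind)" for n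
  obtain K where K: "\<And>(m\<^sub>1::nat) (m\<^sub>2::nat) y. y \<ge> 0 \<Longrightarrow>
    (branch \<sigma>\<^sub>1 ^^ m\<^sub>1) ((branch \<sigma>\<^sub>2 ^^ m\<^sub>2) neg_ind) (\<sigma>\<^sub>2 * front m\<^sub>2 + \<sigma>\<^sub>1 * (front m\<^sub>1 + y)) \<le> K * (y + 5) * exp (- crit * y)"
    using two_speed_upper[OF s] by blast
  have "((\<lambda>y. (y + 5) * exp (- crit * y)) \<longlongrightarrow> 0) at_top" using crit_pos by real_asymp
  then have "((\<lambda>y. K * ((y + 5) * exp (- crit * y))) \<longlongrightarrow> K * 0) at_top" by (rule tendsto_mult_left)
  then have "eventually (\<lambda>y. K * ((y + 5) * exp (- crit * y)) < \<epsilon> / 2) at_top"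
    using e by (intro order_tendstoD) auto
  then have "eventually (\<lambda>y. K * ((y + 5) * exp (- crit * y)) < \<epsilon> / 2 \<and> y \<ge> 0) at_top"
    by (intro eventually_conj eventually_ge_at_top)
  then obtain y where y: "K * ((y + 5) * exp (- crit * y)) < \<epsilon> / 2" "y \<ge> 0"
    using eventually_happens'[OF trivial_limit_at_top_linorder] by blast
  \<comment> \<open>The cap \<open>1\<close> meets the hypothesis of \<open>two_speed_lower\<close>,
    and \<open>\<epsilon> / 4\<close> makes the bound \<open>\<epsilon> / 2\<close> strict.\<close>
  define \<eta> where "\<eta> = min (\<epsilon> / 4) 1"
  have eta: "0 < \<eta>" "\<eta> \<le> 1" "\<eta> < \<epsilon> / 2" using e by (auto simp: \<eta>_def)
  obtain K' where K': "\<And>(m\<^sub>1::nat) (m\<^sub>2::nat).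
    1 - \<eta> \<le> (branch \<sigma>\<^sub>1 ^^ m\<^sub>1) ((branch \<sigma>\<^sub>2 ^^ m\<^sub>2) neg_ind) (\<sigma>\<^sub>2 * mean_pos m\<^sub>2 + \<sigma>\<^sub>1 * mean_pos m\<^sub>1 - K')"
    using two_speed_lower[OF _ s(1) eta(1,2), of \<sigma>\<^sub>1] s by (meson less_trans)
  define B where "B = max ((\<sigma>\<^sub>1 + \<sigma>\<^sub>2) * (crit / 2 + 3 / (2 * crit) * ln 6) + \<sigma>\<^sub>1 * y) (K' + (\<sigma>\<^sub>1 + \<sigma>\<^sub>2) * (crit / 2))"
  show "\<exists>K. \<forall>n\<ge>1. measure (M n) {\<omega> \<in> space (M n). \<bar>max_displacement n (S n) \<omega> - a n\<bar> > K} < \<epsilon>"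
  proof (intro exI[of _ B] allI impI)
    fix n :: nat assume n: "n \<ge> 1"
    interpret two_variance_brw "M n" n \<sigma>\<^sub>1 \<sigma>\<^sub>2 "S n" by (rule brw[OF n])
    define m\<^sub>1 m\<^sub>2 where "m\<^sub>1 = n - n div 2" and "m\<^sub>2 = n div 2"
    let ?X = "max_displacement n (S n)"
    have [measurable]: "?X \<in> borel_measurable (M n)" by (rule max_displacement_measurable)
    have cdf: "prob {\<omega> \<in> space (M n). ?X \<omega> \<le> x} = 1 - (branch \<sigma>\<^sub>1 ^^ m\<^sub>1) ((branch \<sigma>\<^sub>2 ^^ m\<^sub>2) neg_ind) x" for x
      unfolding m\<^sub>1_def m\<^sub>2_def using s by (intro prob_max_displacement) auto
    define xu where "xu = \<sigma>\<^sub>2 * front m\<^sub>2 + \<sigma>\<^sub>1 * (front m\<^sub>1 + y)"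
    define xl where "xl = \<sigma>\<^sub>2 * mean_pos m\<^sub>2 + \<sigma>\<^sub>1 * mean_pos m\<^sub>1 - K'"
    have m2: "2 * real m\<^sub>2 \<le> real n" "real n \<le> 2 * real m\<^sub>2 + 1"
      unfolding m\<^sub>2_def by linarith+
    have m1: "real m\<^sub>1 = real n - real m\<^sub>2" unfolding m\<^sub>1_def m\<^sub>2_def by (simp add: of_nat_diff)
    have mn: "m\<^sub>1 \<le> n" "m\<^sub>2 \<le> n" by (auto simp: m\<^sub>1_def m\<^sub>2_def)
    have "xu \<le> a n + B"
    proof -
      have f1: "\<sigma>\<^sub>1 * front m\<^sub>1 \<le> \<sigma>\<^sub>1 * (crit * real n / 2 - 3 / (2 * crit) * ln (real n) + (crit / 2 + 3 / (2 * crit) * ln 6))"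
        using s m2 m1 by (intro mult_left_mono front_le n) auto
      have f2: "\<sigma>\<^sub>2 * front m\<^sub>2 \<le> \<sigma>\<^sub>2 * (crit * real n / 2 - 3 / (2 * crit) * ln (real n) + (crit / 2 + 3 / (2 * crit) * ln 6))"
        using s m2 by (intro mult_left_mono front_le n) auto
      have "xu = \<sigma>\<^sub>1 * front m\<^sub>1 + \<sigma>\<^sub>2 * front m\<^sub>2 + \<sigma>\<^sub>1 * y" by (simp add: xu_def distrib_left)
      also have "\<dots> \<le> a n + ((\<sigma>\<^sub>1 + \<sigma>\<^sub>2) * (crit / 2 + 3 / (2 * crit) * ln 6) + \<sigma>\<^sub>1 * y)"
        using add_mono[OF f1 f2] unfolding a_def distrib_right distrib_left by linarith
      also have "\<dots> \<le> a n + B" by (simp add: B_def)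
      finally show ?thesis .
    qed
    have "a n - B \<le> xl"
    proof -
      have f1: "\<sigma>\<^sub>1 * (crit * real n / 2 - 3 / (2 * crit) * ln (real n) - crit / 2) \<le> \<sigma>\<^sub>1 * mean_pos m\<^sub>1"
        using s m2 m1 by (intro mult_left_mono mean_pos_ge n mn) auto
      have f2: "\<sigma>\<^sub>2 * (crit * real n / 2 - 3 / (2 * crit) * ln (real n) - crit / 2) \<le> \<sigma>\<^sub>2 * mean_pos m\<^sub>2"
        using s m2 by (intro mult_left_mono mean_pos_ge n mn) auto
      have "a n - (\<sigma>\<^sub>1 + \<sigma>\<^sub>2) * (crit / 2) \<le> \<sigma>\<^sub>1 * mean_pos m\<^sub>1 + \<sigma>\<^sub>2 * mean_pos m\<^sub>2"
        using add_mono[OF f1 f2] unfolding a_def distrib_right right_diff_distrib by linarith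
      then show ?thesis unfolding xl_def B_def by linarith
    qed
    have up: "prob {\<omega> \<in> space (M n). \<not> ?X \<omega> \<le> xu} < \<epsilon> / 2"
    proof -
      have "prob {\<omega> \<in> space (M n). \<not> ?X \<omega> \<le> xu} = 1 - prob {\<omega> \<in> space (M n). ?X \<omega> \<le> xu}"
        by (intro prob_neg) measurable
      then show ?thesis using K[OF y(2), of m\<^sub>1 m\<^sub>2] y(1) unfolding cdf xu_def by (simp add: mult.assoc)
    qed
    have lo: "prob {\<omega> \<in> space (M n). ?X \<omega> \<le> xl} < \<epsilon> / 2"
      using K'[of m\<^sub>1 m\<^sub>2] eta unfolding cdf xl_def by linarith
    have "prob {\<omega> \<in> space (M n). \<bar>?X \<omega> - a n\<bar> > B}
      \<le> prob ({\<omega> \<in> space (M n). \<not> ?X \<omega> \<le> xu} \<union> {\<omega> \<in> space (M n). ?X \<omega> \<le> xl})"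
    proof (rule finite_measure_mono)
      show "{\<omega> \<in> space (M n). \<bar>?X \<omega> - a n\<bar> > B} \<subseteq> {\<omega> \<in> space (M n). \<not> ?X \<omega> \<le> xu} \<union> {\<omega> \<in> space (M n). ?X \<omega> \<le> xl}"
        using \<open>xu \<le> a n + B\<close> \<open>a n - B \<le> xl\<close> by auto
    qed measurable
    also have "\<dots> \<le> prob {\<omega> \<in> space (M n). \<not> ?X \<omega> \<le> xu} + prob {\<omega> \<in> space (M n). ?X \<omega> \<le> xl}"
      by (intro measure_Un_le) measurable
    also have "\<dots> < \<epsilon>" using up lo by linarith
    finally show "prob {\<omega> \<in> space (M n). \<bar>?X \<omega> - a n\<bar> > B} < \<epsilon>" .
  qed
qed

theorem theorem2:
  fixes \<sigma>\<^sub>1 \<sigma>\<^sub>2 :: real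
    and M :: "nat \<Rightarrow> 'a measure"
    and S :: "nat \<Rightarrow> bool list \<Rightarrow> 'a \<Rightarrow> real"
  assumes "\<sigma>\<^sub>1 > 0" and "\<sigma>\<^sub>2 > 0" and "\<sigma>\<^sub>1\<^sup>2 > \<sigma>\<^sub>2\<^sup>2"
    and "\<And>n. n \<ge> 1 \<Longrightarrow> two_variance_brw (M n) n \<sigma>\<^sub>1 \<sigma>\<^sub>2 (S n)"
  shows "stochastically_bounded M (\<lambda>n \<omega>. max_displacement n (S n) \<omega> -
           (sqrt (2 * ln 2) * (\<sigma>\<^sub>1 + \<sigma>\<^sub>2) / 2 * real n
            - 3 * (\<sigma>\<^sub>1 + \<sigma>\<^sub>2) / (2 * sqrt (2 * ln 2)) * ln (real n))) \<and>
        (let \<sigma>_eff = (\<sigma>\<^sub>1 + \<sigma>\<^sub>2) / 2; \<beta> = 3 in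
         stochastically_bounded M (\<lambda>n \<omega>. max_displacement n (S n) \<omega> -
           ((sqrt (2 * ln 2) * \<sigma>_eff) * real n
            - \<beta> * (\<sigma>_eff / sqrt (2 * ln 2)) * ln (real n))))"
proof -
  have "\<sigma>\<^sub>2 < \<sigma>\<^sub>1" using assms(1,3) by (meson less_imp_le power2_less_imp_less)
  note tight = max_displacement_tight[OF assms(2) this assms(4)]
  have "crit * (\<sigma>\<^sub>1 + \<sigma>\<^sub>2) / 2 * real n - 3 * (\<sigma>\<^sub>1 + \<sigma>\<^sub>2) / (2 * crit) * ln (real n)
      = (\<sigma>\<^sub>1 + \<sigma>\<^sub>2) * (crit * real n / 2 - 3 / (2 * crit) * ln (real n))"
    "crit * ((\<sigma>\<^sub>1 + \<sigma>\<^sub>2) / 2) * real n - 3 * ((\<sigma>\<^sub>1 + \<sigma>\<^sub>2) / 2 / crit) * ln (real n)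
      = (\<sigma>\<^sub>1 + \<sigma>\<^sub>2) * (crit * real n / 2 - 3 / (2 * crit) * ln (real n))" for n
    by (simp_all add: algebra_simps add_divide_distrib)
  with tight show ?thesis unfolding Let_def crit_def[symmetric] by simp
qed

end
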